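(* For all integers $k \geq 2$ and $r \geq 3$, \[ s_r(K_{k+1}) \leq (8kr\ln k)^{3}. \]
   Context: All graphs are finite and simple, and $K_n$ denotes the complete graph on $n$ vertices. For graphs $G,H$ and a positive integer $r$, write $G \rightarrow (H)_r$ (and say that $G$ is $r$-Ramsey for $H$) if every colouring of the edges of $G$ with $r$ colours contains a monochromatic copy of $H$ as a (not necessarily induced) subgraph. A graph $G$ is $r$-Ramsey minimal for $H$ if $G \rightarrow (H)_r$ and there is no proper subgraph $G'$ of $G$ with $G' \rightarrow (H)_r$. Let $\mathcal{M}_r(H)$ be the set of all graphs that are $r$-Ramsey minimal for $H$; it is non-empty by Ramsey's theorem. Define \[ s_r(H) = \min_{G \in \mathcal{M}_r(H)} \delta(G), \] where $\delta(G)$ is the minimum degree of $G$. Here $\ln$ is the natural logarithm. *)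

theory Defs
  imports Complex_Main "HOL-Library.Ramsey"
begin

text \<open>A graph is a pair of a vertex set and a set of edges, an edge being a two-element
  set of vertices.\<close>

type_synonym 'a graph = "'a set \<times> 'a set set"

abbreviation vertices :: "'a graph \<Rightarrow> 'a set" where
  "vertices G \<equiv> fst G"

abbreviation edges :: "'a graph \<Rightarrow> 'a set set" where
  "edges G \<equiv> snd G"

definition finite_simple_graph :: "'a graph \<Rightarrow> bool" where
  "finite_simple_graph G \<longleftrightarrow> finite (vertices G) \<and> edges G \<subseteq> [vertices G]\<^bsup>2\<^esup>"

definition subgraph :: "'a graph \<Rightarrow> 'a graph \<Rightarrow> bool" where
  "subgraph G' G \<longleftrightarrow>
     finite_simple_graph G' \<and> finite_simple_graph G \<and>
     vertices G' \<subseteq> vertices G \<and> edges G' \<subseteq> edges G"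

definition complete_graph :: "nat \<Rightarrow> nat graph" where
  "complete_graph n = ({..<n}, [{..<n}]\<^bsup>2\<^esup>)"

definition degree :: "'a graph \<Rightarrow> 'a \<Rightarrow> nat" where
  "degree G v = card {e \<in> edges G. v \<in> e}"

definition min_degree :: "'a graph \<Rightarrow> nat" where
  "min_degree G = Min (degree G ` vertices G)"

text \<open>An injection \<open>\<phi>\<close> of the vertices that sends edges to edges is an embedding of \<open>H\<close> as a
  not necessarily induced subgraph.\<close>

definition embedding :: "('b \<Rightarrow> 'a) \<Rightarrow> 'b graph \<Rightarrow> 'a graph \<Rightarrow> bool" where
  "embedding \<phi> H G \<longleftrightarrow>
     inj_on \<phi> (vertices H) \<and> \<phi> ` vertices H \<subseteq> vertices G \<and>
     (\<forall>e \<in> edges H. \<phi> ` e \<in> edges G)"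

definition ramsey_for :: "nat \<Rightarrow> 'a graph \<Rightarrow> 'b graph \<Rightarrow> bool" where
  "ramsey_for r G H \<longleftrightarrow>
     (\<forall>c \<in> edges G \<rightarrow> {..<r}. \<exists>i<r. \<exists>\<phi>. embedding \<phi> H G \<and> (\<forall>e \<in> edges H. c (\<phi> ` e) = i))"

definition ramsey_minimal_for :: "nat \<Rightarrow> 'a graph \<Rightarrow> 'b graph \<Rightarrow> bool" where
  "ramsey_minimal_for r G H \<longleftrightarrow>
     finite_simple_graph G \<and> ramsey_for r G H \<and>
     \<not> (\<exists>G'. subgraph G' G \<and> G' \<noteq> G \<and> ramsey_for r G' H)"

text \<open>Every finite graph is isomorphic to one whose vertices are natural numbers, so the host
  graphs are taken over \<^typ>\<open>nat\<close>.\<close>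

definition ramsey_minimal_graphs :: "nat \<Rightarrow> 'b graph \<Rightarrow> nat graph set" where
  "ramsey_minimal_graphs r H = {G. ramsey_minimal_for r G H}"

text \<open>The minimum may range over an infinite set of graphs; it is attained, by
  \<open>smallest_min_degree_attained\<close> below.\<close>

definition smallest_min_degree :: "nat \<Rightarrow> 'b graph \<Rightarrow> nat" where
  "smallest_min_degree r H = (LEAST d. d \<in> min_degree ` ramsey_minimal_graphs r H)"

lemma ramsey_for_complete_graph:
  fixes H :: "'b graph"
  assumes H: "finite_simple_graph H"
  shows "\<exists>N. ramsey_for r (complete_graph N) H"
proof -
  define m where "m = card (vertices H)"
  obtain N :: nat where N: "partn_lst {..<N} (replicate r m) 2"
    using ramsey_full[of "replicate r m" 2] by blast
  have "ramsey_for r (complete_graph N) H"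
    unfolding ramsey_for_def
  proof
    fix c :: "nat set \<Rightarrow> nat"
    assume "c \<in> edges (complete_graph N) \<rightarrow> {..<r}"
    then have "c \<in> [{..<N}]\<^bsup>2\<^esup> \<rightarrow> {..<length (replicate r m)}"
      by (simp add: complete_graph_def)
    then have "\<exists>i<length (replicate r m). monochromatic {..<N} (replicate r m ! i) 2 c i"
      using N unfolding partn_lst_def by (rule bspec[rotated])
    then obtain i where i: "i < r" and "monochromatic {..<N} m 2 c i"
      by (metis length_replicate nth_replicate)
    then obtain S where S: "S \<in> [{..<N}]\<^bsup>m\<^esup>" and cS: "c ` [S]\<^bsup>2\<^esup> \<subseteq> {i}"
      unfolding monochromatic_def by blast
    have "S \<subseteq> {..<N}"
      using S by (simp add: nsets_def)
    have "finite S" "card S = card (vertices H)"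
      using S by (simp_all add: nsets_def m_def)
    moreover have "finite (vertices H)"
      using H by (simp add: finite_simple_graph_def)
    ultimately obtain \<phi> where \<phi>: "bij_betw \<phi> (vertices H) S"
      using finite_same_card_bij[of "vertices H" S] by auto
    have S2: "\<phi> ` e \<in> [S]\<^bsup>2\<^esup>" if "e \<in> edges H" for e
    proof -
      have "e \<in> [vertices H]\<^bsup>2\<^esup>"
        using that H unfolding finite_simple_graph_def by blast
      then have e: "e \<subseteq> vertices H" "finite e" "card e = 2"
        by (simp_all add: nsets_def)
      moreover have "inj_on \<phi> e"
        by (rule inj_on_subset[OF bij_betw_imp_inj_on[OF \<phi>] e(1)])
      moreover have "\<phi> ` e \<subseteq> S"
        using \<phi> e(1) by (auto simp: bij_betw_def)
      ultimately show ?thesis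
        by (simp add: nsets_def card_image)
    qed
    have "[S]\<^bsup>2\<^esup> \<subseteq> [{..<N}]\<^bsup>2\<^esup>"
      using \<open>S \<subseteq> {..<N}\<close> nsets_mono by blast
    then have "embedding \<phi> H (complete_graph N)"
      using \<phi> S2 \<open>S \<subseteq> {..<N}\<close>
      unfolding embedding_def complete_graph_def bij_betw_def fst_conv snd_conv by blast
    moreover have "\<forall>e \<in> edges H. c (\<phi> ` e) = i"
      using S2 cS by blast
    ultimately show "\<exists>i<r. \<exists>\<phi>. embedding \<phi> H (complete_graph N) \<and> (\<forall>e \<in> edges H. c (\<phi> ` e) = i)"
      using i by blast
  qed
  then show ?thesis ..
qed

lemma ramsey_minimal_subgraph_exists:
  assumes "finite_simple_graph G" "ramsey_for r G H"
  shows "\<exists>G'. subgraph G' G \<and> ramsey_minimal_for r G' H"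
  using assms
proof (induction "card (vertices G) + card (edges G)" arbitrary: G rule: less_induct)
  case less
  show ?case
  proof (cases "ramsey_minimal_for r G H")
    case True
    moreover have "subgraph G G"
      using less.prems by (simp add: subgraph_def)
    ultimately show ?thesis by blast
  next
    case False
    then obtain G' where G': "subgraph G' G" "G' \<noteq> G" "ramsey_for r G' H"
      using less.prems by (auto simp: ramsey_minimal_for_def)
    have "finite (vertices G)" and "edges G \<subseteq> [vertices G]\<^bsup>2\<^esup>"
      using less.prems(1) by (simp_all add: finite_simple_graph_def)
    moreover from this have "finite (edges G)"
      using finite_subset finite_imp_finite_nsets by blast
    ultimately have fin: "finite (vertices G)" "finite (edges G)"
      by simp_all
    have sub: "vertices G' \<subseteq> vertices G" "edges G' \<subseteq> edges G"
      using G' by (auto simp: subgraph_def)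
    have le: "card (vertices G') \<le> card (vertices G)" "card (edges G') \<le> card (edges G)"
      using fin sub by (simp_all add: card_mono)
    have "vertices G' \<subset> vertices G \<or> edges G' \<subset> edges G"
      using G'(2) sub by (simp add: psubset_eq prod_eq_iff)
    then have "card (vertices G') < card (vertices G) \<or> card (edges G') < card (edges G)"
      using psubset_card_mono[OF fin(1)] psubset_card_mono[OF fin(2)] by blast
    then have "card (vertices G') + card (edges G') < card (vertices G) + card (edges G)"
      using le by linarith
    then obtain G'' where "subgraph G'' G'" "ramsey_minimal_for r G'' H"
      using less.hyps[of G'] G' by (auto simp: subgraph_def)
    moreover have "subgraph G'' G"
      using \<open>subgraph G'' G'\<close> G'(1) by (auto simp: subgraph_def)
    ultimately show ?thesis by blast
  qed
qed

lemma ramsey_minimal_graphs_nonempty: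
  assumes "finite_simple_graph H"
  shows "ramsey_minimal_graphs r H \<noteq> {}"
proof -
  obtain N where "ramsey_for r (complete_graph N) H"
    using ramsey_for_complete_graph assms by blast
  moreover have "finite_simple_graph (complete_graph N)"
    by (simp add: finite_simple_graph_def complete_graph_def)
  ultimately show ?thesis
    using ramsey_minimal_subgraph_exists unfolding ramsey_minimal_graphs_def by blast
qed

lemma smallest_min_degree_attained:
  assumes "finite_simple_graph H"
  obtains G where "G \<in> ramsey_minimal_graphs r H" "min_degree G = smallest_min_degree r H"
proof -
  have "\<exists>d. d \<in> min_degree ` ramsey_minimal_graphs r H"
    using ramsey_minimal_graphs_nonempty[OF assms] by blast
  then have "smallest_min_degree r H \<in> min_degree ` ramsey_minimal_graphs r H"
    unfolding smallest_min_degree_def by (rule LeastI_ex)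
  then show ?thesis
    using that by auto
qed

end

theory Submission
  imports "HOL-Algebra.Algebraic_Closure_Type" "HOL-Library.Z2" "HOL-Library.Nat_Bijection" Defs
begin

text \<open>Two steps give the bound. The first turns the Ramsey problem into a packing problem. Call a family of
\<open>r\<close> edge-disjoint \<open>K_(k+1)\<close>-free graphs on a common vertex set \<open>P\<close> dense if every subset of \<open>P\<close> with at
least \<open>card P / r\<close> elements contains a \<open>K_k\<close> of each of the \<open>r\<close> graphs. If a dense family exists, then
\<open>s_r(K_(k+1)) \<le> card P\<close> (\<open>smallest_min_degree_le_card\<close>). For the proof, regard the family as an edge
colouring of \<open>P\<close> without monochromatic \<open>K_(k+1)\<close>. By \<open>clique_free_colouring_ramsey\<close>, there is a graph
\<open>H\<close> with a colouring that also has no monochromatic \<open>K_(k+1)\<close>, such that for every \<open>r\<close>-colouring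
\<open>\<chi>\<close> of the edges of \<open>H\<close> some copy of \<open>P\<close> in \<open>H\<close> has the property that \<open>\<chi>\<close> on it is a function
\<open>f\<close> of the original colour. Enlarging \<open>P\<close> by disjoint two-coloured cliques \<open>K_(k+1)\<close> forces \<open>f\<close> to be
a permutation of the colours whenever \<open>\<chi>\<close> has no monochromatic \<open>K_(k+1)\<close>. Now join a new vertex to
each \<open>card P\<close>-subset of \<open>H\<close>. Given a colouring of the resulting graph \<open>G\<close> that has no monochromatic
\<open>K_(k+1)\<close> inside \<open>H\<close>, look at the new vertex joined to the copy of \<open>P\<close>. By the pigeonhole principle,
at least \<open>card P / r\<close> of its edges have one colour \<open>a = f j\<close>, and density yields a \<open>K_k\<close> among their
ends in colour \<open>a\<close>, hence a monochromatic \<open>K_(k+1)\<close>. So \<open>G\<close> is Ramsey, while \<open>H\<close> is not: a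
minimal Ramsey subgraph of \<open>G\<close> contains a new vertex, and its degree is at most \<open>card P\<close>.

The Ramsey theorem for clique-free colourings comes from the partite construction of Nesetril and
Rodl. Its two ingredients are a Ramsey theorem for edge-coloured bipartite graphs
(\<open>coloured_bipartite_ramsey\<close>), and the fact that a free amalgam along induced bipartite subgraphs
creates no new clique of size at least three (\<open>clique_free_colouring_amalgam\<close>).

The second step constructs a dense family on \<open>q ^ 3\<close> vertices, for \<open>q\<close> a power of two with
\<open>2 k r ln k < q \<le> 4 k r ln k\<close>. The vertices are the points of the affine space \<open>F \<times> F \<times> F\<close> over the field
\<open>F\<close> with \<open>q\<close> elements. The graph with index \<open>j\<close> lives on the lines with directions
\<open>(1, t, t\<^sup>2 + \<gamma> j)\<close>. These directions lie on a conic, so no three of them are coplanar and the lines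
form no triangle (\<open>space_line_triangle_free\<close>); every clique is therefore contained in a line. Splitting
the points of each line into \<open>k\<close> classes and joining points of different classes gives a
\<open>K_(k+1)\<close>-free graph. For random splittings, a fixed set with at least \<open>q ^ 3 / r\<close> points meets all
\<open>k\<close> classes of some line except with probability below \<open>k powr (- q ^ 3)\<close>, which beats the number
\<open>2 ^ (q ^ 3)\<close> of sets (\<open>exists_line_partition_meeting_large_sets\<close>).\<close>

section \<open>Clique-free edge colourings\<close>

text \<open>The value \<open>r\<close> marks a non-adjacent pair. In this way one symmetric function encodes \<open>r\<close> edge-disjoint
graphs, none of which contains a clique with \<open>m\<close> vertices.\<close>

definition clique_free_colouring :: "nat \<Rightarrow> nat \<Rightarrow> 'a set \<Rightarrow> ('a \<Rightarrow> 'a \<Rightarrow> nat) \<Rightarrow> bool" where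
  "clique_free_colouring r m V c \<longleftrightarrow>
     finite V \<and> (\<forall>u\<in>V. \<forall>v\<in>V. c u v \<le> r \<and> c u v = c v u) \<and> (\<forall>v\<in>V. c v v = r) \<and>
     (\<forall>S\<subseteq>V. \<forall>j<r. card S = m \<longrightarrow> (\<exists>u\<in>S. \<exists>v\<in>S. u \<noteq> v \<and> c u v \<noteq> j))"

text \<open>Non-edges are preserved as well: copies are induced. Otherwise the edges of several overlapping
copies could combine to a clique that none of the copies contains.\<close>

definition colour_embedding ::
    "('a \<Rightarrow> 'b) \<Rightarrow> 'a set \<Rightarrow> ('a \<Rightarrow> 'a \<Rightarrow> nat) \<Rightarrow> 'b set \<Rightarrow> ('b \<Rightarrow> 'b \<Rightarrow> nat) \<Rightarrow> bool" where
  "colour_embedding \<phi> V c V' c' \<longleftrightarrow>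
     inj_on \<phi> V \<and> \<phi> ` V \<subseteq> V' \<and> (\<forall>u\<in>V. \<forall>v\<in>V. c' (\<phi> u) (\<phi> v) = c u v)"

lemma colour_embedding_compose:
  assumes "colour_embedding \<phi> V c V' c'" "colour_embedding \<psi> V' c' V'' c''"
  shows "colour_embedding (\<lambda>v. \<psi> (\<phi> v)) V c V'' c''"
  using assms unfolding colour_embedding_def inj_on_def by (auto simp: image_subset_iff)

text \<open>A monochromatic clique inside an induced copy can be pulled back to the original. For
graphs that are glued from copies, it then remains to locate a clique inside a single copy.\<close>

lemma no_clique_in_copy:
  assumes V: "clique_free_colouring r m V c" and \<phi>: "colour_embedding \<phi> V c V' c'"
    and S: "S \<subseteq> \<phi> ` V" "card S = m" and j: "j < r"
  shows "\<exists>u\<in>S. \<exists>v\<in>S. u \<noteq> v \<and> c' u v \<noteq> j"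
proof -
  define T where "T = {v \<in> V. \<phi> v \<in> S}"
  have T: "T \<subseteq> V" "\<phi> ` T = S" using S(1) by (auto simp: T_def)
  have inj: "inj_on \<phi> V" using \<phi> by (simp add: colour_embedding_def)
  have "card T = m" using card_image[OF inj_on_subset[OF inj T(1)]] T S(2) by simp
  then obtain u v where uv: "u \<in> T" "v \<in> T" "u \<noteq> v" "c u v \<noteq> j"
    using V T(1) j unfolding clique_free_colouring_def by blast
  have "\<phi> u \<noteq> \<phi> v" using uv T(1) inj by (auto simp: inj_on_def)
  moreover have "u \<in> V" "v \<in> V" using uv T(1) by auto
  then have "c' (\<phi> u) (\<phi> v) \<noteq> j" using uv(4) \<phi> by (simp add: colour_embedding_def)
  ultimately show ?thesis using uv T(2) by blast
qed

definition image_colouring :: "'a set \<Rightarrow> ('a \<Rightarrow> 'b) \<Rightarrow> ('a \<Rightarrow> 'a \<Rightarrow> nat) \<Rightarrow> 'b \<Rightarrow> 'b \<Rightarrow> nat" where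
  "image_colouring V e c x y = c (inv_into V e x) (inv_into V e y)"

lemma colour_embedding_image:
  assumes "inj_on e V"
  shows "colour_embedding e V c (e ` V) (image_colouring V e c)"
  using assms by (auto simp: colour_embedding_def image_colouring_def)

lemma clique_free_colouring_image:
  assumes "clique_free_colouring r m V c" "inj_on e V"
  shows "clique_free_colouring r m (e ` V) (image_colouring V e c)"
  unfolding clique_free_colouring_def
proof (intro conjI allI impI ballI)
  fix S j assume "S \<subseteq> e ` V" "j < r" "card S = m"
  then show "\<exists>u\<in>S. \<exists>v\<in>S. u \<noteq> v \<and> image_colouring V e c u v \<noteq> j"
    using no_clique_in_copy[OF assms(1) colour_embedding_image[OF assms(2)]] by blast
qed (use assms in \<open>auto simp: clique_free_colouring_def image_colouring_def\<close>)

text \<open>The disjoint union of the coloured graphs \<open>c i\<close>.\<close>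

definition family_colour :: "nat \<Rightarrow> ('i \<Rightarrow> 'a \<Rightarrow> 'a \<Rightarrow> nat) \<Rightarrow> 'i \<times> 'a \<Rightarrow> 'i \<times> 'a \<Rightarrow> nat" where
  "family_colour r c = (\<lambda>(i, x) (j, y). if i = j then c i x y else r)"

lemma colour_embedding_family:
  assumes "i \<in> I"
  shows "colour_embedding (Pair i) (V i) (c i) (Sigma I V) (family_colour r c)"
  using assms by (auto simp: colour_embedding_def family_colour_def inj_on_def)

lemma clique_free_colouring_family:
  assumes m: "0 < m" and I: "finite I" and V: "\<And>i. i \<in> I \<Longrightarrow> clique_free_colouring r m (V i) (c i)"
  shows "clique_free_colouring r m (Sigma I V) (family_colour r c)"
  unfolding clique_free_colouring_def
proof (intro conjI allI impI)
  show "finite (Sigma I V)"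
    using I V by (intro finite_SigmaI) (auto simp: clique_free_colouring_def)
  show "\<forall>u\<in>Sigma I V. \<forall>v\<in>Sigma I V. family_colour r c u v \<le> r \<and> family_colour r c u v = family_colour r c v u"
    using V by (auto simp: clique_free_colouring_def family_colour_def)
  show "\<forall>v\<in>Sigma I V. family_colour r c v v = r"
    using V by (auto simp: clique_free_colouring_def family_colour_def)
  fix S j assume S: "S \<subseteq> Sigma I V" "j < r" "card S = m"
  show "\<exists>u\<in>S. \<exists>v\<in>S. u \<noteq> v \<and> family_colour r c u v \<noteq> j"
  proof (rule ccontr)
    assume "\<not> ?thesis"
    then have mono: "family_colour r c u v = j" if "u \<in> S" "v \<in> S" "u \<noteq> v" for u v
      using that by blast
    have "S \<noteq> {}" using S(3) m by auto
    then obtain i x where ix: "(i, x) \<in> S" by auto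
    have "s \<in> Pair i ` V i" if s: "s \<in> S" for s
    proof -
      obtain i' y where y: "s = (i', y)" "y \<in> V i'" using s S(1) by auto
      have "i' = i"
      proof (rule ccontr)
        assume "i' \<noteq> i"
        then show False using mono[OF ix s] S(2) y(1) by (simp add: family_colour_def)
      qed
      then show ?thesis using y by blast
    qed
    then have sub: "S \<subseteq> Pair i ` V i" by blast
    have iI: "i \<in> I" using ix S(1) by auto
    obtain u v where "u \<in> S" "v \<in> S" "u \<noteq> v" "family_colour r c u v \<noteq> j"
      using no_clique_in_copy[OF V[OF iI] colour_embedding_family[OF iI, of V c r] sub S(3,2)] by blast
    then show False using mono by blast
  qed
qed

section \<open>Free amalgams\<close>

text \<open>In the free amalgam, each map \<open>\<phi>\<close> embeds the part on \<open>U\<close> of a fixed coloured graph on \<open>V\<close> into a base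
graph; the rest of \<open>V\<close> is attached as a fresh copy, tagged with \<open>\<phi>\<close>, and there are no edges between
fresh vertices of different copies.\<close>

fun amalgam_colour :: "nat \<Rightarrow> 'a set \<Rightarrow> ('a \<Rightarrow> 'a \<Rightarrow> nat) \<Rightarrow> ('b \<Rightarrow> 'b \<Rightarrow> nat) \<Rightarrow>
    'b + ('a \<Rightarrow> 'b) \<times> 'a \<Rightarrow> 'b + ('a \<Rightarrow> 'b) \<times> 'a \<Rightarrow> nat" where
  "amalgam_colour r U c d (Inl x) (Inl y) = d x y"
| "amalgam_colour r U c d (Inl x) (Inr (\<phi>, w)) = (if x \<in> \<phi> ` U then c (inv_into U \<phi> x) w else r)"
| "amalgam_colour r U c d (Inr (\<phi>, w)) (Inl x) = (if x \<in> \<phi> ` U then c (inv_into U \<phi> x) w else r)"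
| "amalgam_colour r U c d (Inr (\<phi>, v)) (Inr (\<psi>, w)) = (if \<phi> = \<psi> then c v w else r)"

definition amalgam_vertices :: "'a set \<Rightarrow> 'a set \<Rightarrow> 'b set \<Rightarrow> ('a \<Rightarrow> 'b) set \<Rightarrow>
    ('b + ('a \<Rightarrow> 'b) \<times> 'a) set" where
  "amalgam_vertices U V B \<Phi> = Inl ` B \<union> Inr ` (\<Phi> \<times> (V - U))"

definition amalgam_copy :: "'a set \<Rightarrow> ('a \<Rightarrow> 'b) \<Rightarrow> 'a \<Rightarrow> 'b + ('a \<Rightarrow> 'b) \<times> 'a" where
  "amalgam_copy U \<phi> v = (if v \<in> U then Inl (\<phi> v) else Inr (\<phi>, v))"

lemma colour_embedding_amalgam_copy:
  assumes V: "clique_free_colouring r m V c" and U: "U \<subseteq> V"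
    and \<phi>: "\<phi> \<in> \<Phi>" "colour_embedding \<phi> U c B d"
  shows "colour_embedding (amalgam_copy U \<phi>) V c (amalgam_vertices U V B \<Phi>) (amalgam_colour r U c d)"
proof -
  have inj: "inj_on \<phi> U" using \<phi>(2) by (simp add: colour_embedding_def)
  have "c u v = c v u" if "u \<in> V" "v \<in> V" for u v
    using V that by (auto simp: clique_free_colouring_def)
  then show ?thesis
    using \<phi> U inj unfolding colour_embedding_def amalgam_vertices_def amalgam_copy_def
    by (auto simp: inj_on_def image_subset_iff inv_into_f_f[OF inj])
qed

text \<open>A clique that contains a fresh vertex of the copy tagged with \<open>\<phi>\<close> lies entirely in that copy, since all
neighbours of the fresh vertex do. A clique without fresh vertices lies in the base graph.\<close>

lemma clique_free_colouring_amalgam: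
  assumes V: "clique_free_colouring r m V c" and B: "clique_free_colouring r m B d" and U: "U \<subseteq> V"
    and \<Phi>: "finite \<Phi>" "\<And>\<phi>. \<phi> \<in> \<Phi> \<Longrightarrow> colour_embedding \<phi> U c B d"
  shows "clique_free_colouring r m (amalgam_vertices U V B \<Phi>) (amalgam_colour r U c d)"
    (is "clique_free_colouring r m ?A ?a")
  unfolding clique_free_colouring_def
proof (intro conjI allI impI)
  show "finite ?A"
    using V B \<Phi>(1) by (auto simp: amalgam_vertices_def clique_free_colouring_def)
  have inv: "inv_into U \<phi> x \<in> V" if "x \<in> \<phi> ` U" for \<phi> :: "'a \<Rightarrow> 'b" and x
    using inv_into_into[OF that] U by blast
  have inv': "inv_into U \<phi> (\<phi> u) \<in> V" if "u \<in> U" for \<phi> :: "'a \<Rightarrow> 'b" and u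
    using inv that by blast
  have cV: "c u v \<le> r" "c u v = c v u" if "u \<in> V" "v \<in> V" for u v
    using V that by (auto simp: clique_free_colouring_def)
  show "\<forall>u\<in>?A. \<forall>v\<in>?A. ?a u v \<le> r \<and> ?a u v = ?a v u"
    using B cV inv' by (auto simp: amalgam_vertices_def clique_free_colouring_def)
  show "\<forall>v\<in>?A. ?a v v = r"
    using V B by (auto simp: amalgam_vertices_def clique_free_colouring_def)
  fix S j assume S: "S \<subseteq> ?A" and j: "j < r" and card: "card S = m"
  show "\<exists>u\<in>S. \<exists>v\<in>S. u \<noteq> v \<and> ?a u v \<noteq> j"
  proof (cases "S \<subseteq> Inl ` B")
    case True
    have "colour_embedding Inl B d ?A ?a"
      by (auto simp: colour_embedding_def amalgam_vertices_def)
    then show ?thesis using no_clique_in_copy[OF B _ True card j] by blast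
  next
    case False
    then obtain s where "s \<in> S" "s \<notin> Inl ` B" by blast
    moreover from this S have "s \<in> ?A" by blast
    ultimately obtain \<phi> w where w: "Inr (\<phi>, w) \<in> S" "\<phi> \<in> \<Phi>" "w \<in> V" "w \<notin> U"
      by (auto simp: amalgam_vertices_def)
    show ?thesis
    proof (rule ccontr)
      assume "\<not> ?thesis"
      then have mono: "?a u v = j" if "u \<in> S" "v \<in> S" "u \<noteq> v" for u v using that by blast
      have "s \<in> amalgam_copy U \<phi> ` V" if s: "s \<in> S" for s
      proof (cases "s = Inr (\<phi>, w)")
        case True
        then have "s = amalgam_copy U \<phi> w" using w(4) by (simp add: amalgam_copy_def)
        then show ?thesis using w(3) by (rule image_eqI)
      next
        case False
        then have a: "?a s (Inr (\<phi>, w)) = j" using mono[OF s w(1)] by simp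
        have "s \<in> ?A" using S s by blast
        then consider x where "s = Inl x" | \<psi> v where "s = Inr (\<psi>, v)" "v \<in> V" "v \<notin> U"
          unfolding amalgam_vertices_def by blast
        then show ?thesis
        proof cases
          case 1
          then have "x \<in> \<phi> ` U" using a j by (auto split: if_splits)
          then obtain u where "u \<in> U" "x = \<phi> u" by blast
          then have "s = amalgam_copy U \<phi> u" "u \<in> V" using 1 U by (auto simp: amalgam_copy_def)
          then show ?thesis by (rule image_eqI)
        next
          case 2
          then have "\<psi> = \<phi>" using a j by (auto split: if_splits)
          then have "s = amalgam_copy U \<phi> v" using 2 by (simp add: amalgam_copy_def)
          then show ?thesis using 2(2) by (rule image_eqI)
        qed
      qed
      then have sub: "S \<subseteq> amalgam_copy U \<phi> ` V" by blast
      obtain u v where "u \<in> S" "v \<in> S" "u \<noteq> v" "?a u v \<noteq> j"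
        using no_clique_in_copy[OF V colour_embedding_amalgam_copy[OF V U w(2) \<Phi>(2)[OF w(2)]] sub card j]
        by blast
      then show False using mono by blast
    qed
  qed
qed

section \<open>A Ramsey theorem for edge-coloured bipartite graphs\<close>

lemma pigeonhole_average:
  assumes "finite A" "finite B" "B \<noteq> {}" "f \<in> A \<rightarrow> B"
  shows "\<exists>b\<in>B. card A \<le> card B * card {x \<in> A. f x = b}"
proof (rule ccontr)
  assume "\<not> ?thesis"
  then have less: "card B * card {x \<in> A. f x = b} < card A" if "b \<in> B" for b
    using that by (simp add: not_le)
  have "card A = (\<Sum>b\<in>B. card {x \<in> A. f x = b})"
    using sum.group[of A B f "\<lambda>_. 1::nat"] assms by (simp add: image_subset_iff_funcset)
  then have "card B * card A = (\<Sum>b\<in>B. card B * card {x \<in> A. f x = b})"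
    by (simp add: sum_distrib_left)
  also have "\<dots> < (\<Sum>b\<in>B. card A)"
    using assms less by (intro sum_strict_mono) auto
  finally show False by simp
qed

text \<open>In the applications, the colours of the \<open>K\<close>-sets are themselves functions that record a pattern of
colours.\<close>

lemma ramsey_finite_colours:
  fixes C :: "'c set"
  assumes "finite C"
  shows "\<exists>N::nat. \<forall>f \<in> [{..<N}]\<^bsup>K\<^esup> \<rightarrow> C. \<exists>Z \<in> [{..<N}]\<^bsup>m\<^esup>. \<exists>c\<in>C. \<forall>y \<in> [Z]\<^bsup>K\<^esup>. f y = c"
proof -
  obtain g where g: "bij_betw g C {0..<card C}"
    using ex_bij_betw_finite_nat[OF assms] by blast
  obtain N :: nat where N: "partn_lst {..<N} (replicate (card C) m) K"
    using ramsey_full[of "replicate (card C) m" K] by blast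
  have "\<exists>Z \<in> [{..<N}]\<^bsup>m\<^esup>. \<exists>c\<in>C. \<forall>y \<in> [Z]\<^bsup>K\<^esup>. f y = c"
    if f: "f \<in> [{..<N}]\<^bsup>K\<^esup> \<rightarrow> C" for f
  proof -
    have "(\<lambda>y. g (f y)) \<in> [{..<N}]\<^bsup>K\<^esup> \<rightarrow> {..<card C}"
      using f g by (fastforce simp: bij_betw_def)
    then obtain i Z where i: "i < card C" and Z1: "Z \<in> [{..<N}]\<^bsup>(replicate (card C) m ! i)\<^esup>"
      and Z2: "(\<lambda>y. g (f y)) ` [Z]\<^bsup>K\<^esup> \<subseteq> {i}"
      by (rule partn_lstE[OF N]) auto
    then have Z: "Z \<in> [{..<N}]\<^bsup>m\<^esup>" "\<And>y. y \<in> [Z]\<^bsup>K\<^esup> \<Longrightarrow> g (f y) = i"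
      by auto
    have sub: "[Z]\<^bsup>K\<^esup> \<subseteq> [{..<N}]\<^bsup>K\<^esup>"
      using Z(1) by (auto simp: nsets_def)
    obtain c where c: "c \<in> C" "g c = i"
      using g i by (metis bij_betw_imp_surj_on atLeast0LessThan lessThan_iff imageE)
    have "f y = c" if "y \<in> [Z]\<^bsup>K\<^esup>" for y
    proof -
      have "f y \<in> C" using f sub that by blast
      then show ?thesis using Z(2)[OF that] c g by (auto simp: bij_betw_def inj_on_def)
    qed
    then show ?thesis using Z(1) c(1) by blast
  qed
  then show ?thesis by blast
qed

definition rank_in :: "nat set \<Rightarrow> nat \<Rightarrow> nat" where
  "rank_in y x = card {z \<in> y. z < x}"

text \<open>The rank recovers the index of an element from the set alone, without reference to the enumeration
\<open>h\<close>.\<close>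

lemma rank_in_image:
  assumes "strict_mono_on {..<K} h" "p < K"
  shows "rank_in (h ` {..<K}) (h p) = p"
proof -
  have less: "h i < h j \<longleftrightarrow> i < j" if "i < K" "j < K" for i j
    using assms(1) that by (simp add: strict_mono_on_less)
  have "{z \<in> h ` {..<K}. z < h p} = h ` {..<p}"
    using assms(2) less by auto
  moreover have "inj_on h {..<p}"
    using assms by (auto intro!: inj_on_subset[OF strict_mono_on_imp_inj_on])
  ultimately show ?thesis by (simp add: rank_in_def card_image)
qed

text \<open>The host for bipartite graphs: one side consists of the numbers below some \<open>N\<close>, the other of their
\<open>K\<close>-subsets, adjacency is membership, and the colour of an edge is the rank of the element modulo
\<open>r\<close>. Running through the colours cyclically puts an edge of every colour into each block of \<open>r\<close>
consecutive ranks.\<close>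

definition incidence_colour :: "nat \<Rightarrow> nat \<Rightarrow> nat set \<Rightarrow> nat" where
  "incidence_colour r x y = (if x \<in> y then rank_in y x mod r else r)"

definition uniform_bipartite_copy :: "nat \<Rightarrow> nat \<Rightarrow> nat \<Rightarrow> (nat \<Rightarrow> nat set \<Rightarrow> nat) \<Rightarrow>
    'a set \<Rightarrow> 'b set \<Rightarrow> ('a \<Rightarrow> 'b \<Rightarrow> nat) \<Rightarrow> ('a \<Rightarrow> nat) \<Rightarrow> ('b \<Rightarrow> nat set) \<Rightarrow> (nat \<Rightarrow> nat) \<Rightarrow> bool" where
  "uniform_bipartite_copy r N K \<chi> L R c \<alpha> \<beta> f \<longleftrightarrow>
     inj_on \<alpha> L \<and> \<alpha> ` L \<subseteq> {..<N} \<and> \<beta> ` R \<subseteq> [{..<N}]\<^bsup>K\<^esup> \<and> (\<forall>j<r. f j < r) \<and>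
     (\<forall>x\<in>L. \<forall>y\<in>R. incidence_colour r (\<alpha> x) (\<beta> y) = c x y \<and>
        (c x y < r \<longrightarrow> \<chi> (\<alpha> x) (\<beta> y) = f (c x y)))"

text \<open>A colouring \<open>\<chi>\<close> of the incidences assigns to every \<open>K\<close>-set the pattern of the colours at its \<open>K\<close>
ranks. Ramsey's theorem gives a large set \<open>Z\<close> all of whose \<open>K\<close>-subsets have the same pattern
\<open>g\<close>. Cut the ranks into blocks of length \<open>r\<close>. There are \<open>card L * r ^ r\<close> blocks, so \<open>card L\<close> of them
show the same restricted pattern \<open>f\<close>. Give each \<open>x \<in> L\<close> its own block among these, and an element
\<open>\<alpha> x\<close> of \<open>Z\<close>. For \<open>y \<in> R\<close>, the \<open>K\<close>-set \<open>\<beta> y\<close> is chosen such that \<open>\<alpha> x\<close> has rank \<open>c x y\<close> within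
the block of \<open>x\<close>, or such that it avoids \<open>\<alpha> x\<close> if \<open>x\<close> and \<open>y\<close> are not adjacent.\<close>

lemma coloured_bipartite_ramsey_hom:
  fixes L :: "'a set" and R :: "'b set" and c :: "'a \<Rightarrow> 'b \<Rightarrow> nat"
  assumes L: "finite L" and r: "0 < r" and c: "\<forall>x\<in>L. \<forall>y\<in>R. c x y \<le> r"
  shows "\<exists>N K. \<forall>\<chi> :: nat \<Rightarrow> nat set \<Rightarrow> nat. (\<forall>x y. \<chi> x y < r) \<longrightarrow>
    (\<exists>\<alpha> \<beta> f. uniform_bipartite_copy r N K \<chi> L R c \<alpha> \<beta> f)"
proof -
  define M where "M = card L * r ^ r"
  define K where "K = M * r"
  define C where "C = {..<K} \<rightarrow>\<^sub>E {..<r}"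
  have "finite C" unfolding C_def by (intro finite_PiE) auto
  then obtain N :: nat where N: "\<And>f. f \<in> [{..<N}]\<^bsup>K\<^esup> \<rightarrow> C \<Longrightarrow>
      \<exists>Z \<in> [{..<N}]\<^bsup>(2 * K)\<^esup>. \<exists>c\<in>C. \<forall>y \<in> [Z]\<^bsup>K\<^esup>. f y = c"
    using ramsey_finite_colours[of C K "2 * K"] by blast
  have "\<exists>\<alpha> \<beta> f. uniform_bipartite_copy r N K \<chi> L R c \<alpha> \<beta> f"
    if \<chi>: "\<forall>x y. \<chi> x y < r" for \<chi> :: "nat \<Rightarrow> nat set \<Rightarrow> nat"
  proof -
    define pat where "pat = (\<lambda>y. \<lambda>p\<in>{..<K}. \<chi> (SOME x. x \<in> y \<and> rank_in y x = p) y)"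
    have "pat \<in> [{..<N}]\<^bsup>K\<^esup> \<rightarrow> C"
      using \<chi> by (auto simp: pat_def C_def)
    then obtain Z g where Z: "Z \<in> [{..<N}]\<^bsup>(2 * K)\<^esup>" and g: "g \<in> C"
      and hom: "\<And>y. y \<in> [Z]\<^bsup>K\<^esup> \<Longrightarrow> pat y = g"
      using N by blast
    have Z': "finite Z" "card Z = 2 * K" "Z \<subseteq> {..<N}"
      using Z by (auto simp: nsets_def)
    define \<zeta> where "\<zeta> = (\<lambda>i. sorted_list_of_set Z ! i)"
    have \<zeta>_mono: "\<zeta> i < \<zeta> j" if "i < j" "j < 2 * K" for i j
      using Z' that unfolding \<zeta>_def
      by (intro sorted_wrt_nth_less[of "(<)"]) auto
    then have \<zeta>_inj: "\<zeta> i = \<zeta> j \<longleftrightarrow> i = j" if "i < 2 * K" "j < 2 * K" for i j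
      using that by (metis less_irrefl linorder_neqE_nat)
    have \<zeta>_in: "\<zeta> i \<in> Z" if "i < 2 * K" for i
      using Z' that unfolding \<zeta>_def by (metis nth_mem set_sorted_list_of_set sorted_list_of_set.length_sorted_key_list_of_set)
    define v where "v = (\<lambda>u. \<lambda>j\<in>{..<r}. g (u * r + j))"
    have block: "u * r + j < K" if "u < M" "j < r" for u j
    proof -
      have "u * r + j < Suc u * r" using that by simp
      also have "\<dots> \<le> K" unfolding K_def using that by (intro mult_le_mono1) simp
      finally show ?thesis .
    qed
    have gK: "g p < r" if "p < K" for p using g that by (auto simp: C_def)
    have "v \<in> {..<M} \<rightarrow> ({..<r} \<rightarrow>\<^sub>E {..<r})"
      using gK block by (auto simp: v_def)
    then obtain f where f: "f \<in> {..<r} \<rightarrow>\<^sub>E {..<r}"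
      and "M \<le> r ^ r * card {u \<in> {..<M}. v u = f}"
      using pigeonhole_average[of "{..<M}" "{..<r} \<rightarrow>\<^sub>E {..<r}" v] r
      by (auto simp: card_funcsetE finite_PiE PiE_eq_empty_iff)
    then have "card L \<le> card {u \<in> {..<M}. v u = f}"
      using r by (simp add: M_def mult.commute)
    then obtain s where s_in: "s ` L \<subseteq> {u \<in> {..<M}. v u = f}" and s: "inj_on s L"
      using card_le_inj[OF L, of "{u \<in> {..<M}. v u = f}"] by auto
    have sM: "s x < M" "v (s x) = f" if "x \<in> L" for x using s_in that by auto
    \<comment> \<open>Reserve \<open>2 * r\<close> consecutive indices of \<open>Z\<close> for each block, and put \<open>\<alpha> x\<close> at offset \<open>r\<close>. The
      \<open>j\<close>-th element of \<open>\<beta> y\<close> in a block has offset \<open>off i j\<close>: this is increasing in \<open>j < r\<close> and hits the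
      offset \<open>r\<close> exactly for \<open>j = i\<close>. For the default \<open>i = r\<close>, the offset \<open>r\<close> is never hit.\<close>
    define off where "off = (\<lambda>i j. if j < i then j else if j = i then r else r + j)"
    have off_less: "off i j < 2 * r" if "j < r" for i j
      using that by (auto simp: off_def)
    have off_mono: "off i j < off i j'" if "j < j'" "j' < r" for i j j'
      using that by (auto simp: off_def)
    have off_eq: "off i j = r \<longleftrightarrow> j = i" if "j < r" for i j
      using that by (auto simp: off_def)
    define lab where "lab = (\<lambda>y u. if u \<in> s ` L then c (inv_into L s u) y else r)"
    have lab: "lab y (s x) = c x y" if "x \<in> L" for x y
      using that s by (simp add: lab_def)
    define idx where "idx = (\<lambda>y p. 2 * r * (p div r) + off (lab y (p div r)) (p mod r))"
    have idx_less: "idx y p < 2 * K" if "p < K" for y p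
    proof -
      have "p div r < M" using that by (simp add: K_def less_mult_imp_div_less)
      then have "2 * r * Suc (p div r) \<le> 2 * r * M" by (intro mult_le_mono2) simp
      moreover have "idx y p < 2 * r * Suc (p div r)"
        using off_less[of "p mod r" "lab y (p div r)"] r by (simp add: idx_def)
      ultimately show ?thesis by (simp add: K_def mult_ac)
    qed
    have idx_mono: "idx y p < idx y p'" if "p < p'" for y p p'
    proof (cases "p div r = p' div r")
      case True
      then have "p mod r < p' mod r"
        using that by (metis div_mult_mod_eq nat_add_left_cancel_less)
      then show ?thesis using True off_mono r by (simp add: idx_def)
    next
      case False
      then have "p div r < p' div r" using that by (simp add: div_le_mono le_neq_implies_less)
      then have "2 * r * Suc (p div r) \<le> 2 * r * (p' div r)" by (intro mult_le_mono2) simp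
      moreover have "idx y p < 2 * r * Suc (p div r)"
        using off_less[of "p mod r" "lab y (p div r)"] r by (simp add: idx_def)
      ultimately show ?thesis by (simp add: idx_def)
    qed
    define \<alpha> where "\<alpha> = (\<lambda>x. \<zeta> (2 * r * s x + r))"
    define h where "h = (\<lambda>y p. \<zeta> (idx y p))"
    define \<beta> where "\<beta> = (\<lambda>y. h y ` {..<K})"
    have mid_less: "2 * r * s x + r < 2 * K" if "x \<in> L" for x
    proof -
      have "2 * r * Suc (s x) \<le> 2 * r * M" using sM(1)[OF that] by (intro mult_le_mono2) simp
      then show ?thesis using r by (simp add: K_def mult_ac)
    qed
    have h_mono: "strict_mono_on {..<K} (h y)" for y
      by (rule strict_mono_onI) (simp add: h_def \<zeta>_mono idx_less idx_mono)
    have \<beta>_nsets: "\<beta> y \<in> [Z]\<^bsup>K\<^esup>" for y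
      using strict_mono_on_imp_inj_on[OF h_mono] \<zeta>_in idx_less
      by (auto simp: nsets_def \<beta>_def card_image h_def)
    have "inj_on \<alpha> L"
      using s r by (auto simp: inj_on_def \<alpha>_def \<zeta>_inj mid_less)
    moreover have "\<alpha> ` L \<subseteq> {..<N}"
      using Z' \<zeta>_in mid_less by (auto simp: \<alpha>_def)
    moreover have "\<beta> ` R \<subseteq> [{..<N}]\<^bsup>K\<^esup>"
      using \<beta>_nsets nsets_mono[OF Z'(3)] by blast
    moreover have "\<forall>j<r. f j < r" using f by auto
    moreover have "incidence_colour r (\<alpha> x) (\<beta> y) = c x y \<and>
                      (c x y < r \<longrightarrow> \<chi> (\<alpha> x) (\<beta> y) = f (c x y))"
      if x: "x \<in> L" and y: "y \<in> R" for x y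
    proof (cases "c x y < r")
      case True
      define p where "p = s x * r + c x y"
      have pK: "p < K" using block sM(1)[OF x] True by (simp add: p_def)
      have pdiv: "p div r = s x" "p mod r = c x y" using True r by (simp_all add: p_def)
      then have \<alpha>: "\<alpha> x = h y p"
        using True lab[OF x] off_eq[of "c x y" "c x y"] by (simp add: \<alpha>_def h_def idx_def)
      have rank: "rank_in (\<beta> y) (h y p') = p'" if "p' < K" for p'
        unfolding \<beta>_def using h_mono that by (rule rank_in_image)
      have in\<beta>: "\<alpha> x \<in> \<beta> y" using \<alpha> pK by (auto simp: \<beta>_def)
      have "(SOME z. z \<in> \<beta> y \<and> rank_in (\<beta> y) z = p) = \<alpha> x"
      proof (rule some_equality)
        show "\<alpha> x \<in> \<beta> y \<and> rank_in (\<beta> y) (\<alpha> x) = p"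
          using in\<beta> rank[OF pK] \<alpha> by simp
        fix z assume z: "z \<in> \<beta> y \<and> rank_in (\<beta> y) z = p"
        then obtain p' where "p' < K" "z = h y p'" by (auto simp: \<beta>_def)
        then show "z = \<alpha> x" using z rank \<alpha> by auto
      qed
      then have "\<chi> (\<alpha> x) (\<beta> y) = g p"
        using fun_cong[OF hom[OF \<beta>_nsets, of y], of p] pK by (simp add: pat_def)
      also have "\<dots> = v (s x) (c x y)" using True by (simp add: v_def p_def)
      finally show ?thesis
        using in\<beta> rank[OF pK] \<alpha> pdiv(2) sM(2)[OF x] by (simp add: incidence_colour_def)
    next
      case False
      have "\<alpha> x \<notin> \<beta> y"
      proof
        assume "\<alpha> x \<in> \<beta> y"
        then obtain p where p: "p < K" "\<zeta> (2 * r * s x + r) = \<zeta> (idx y p)"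
          by (auto simp: \<beta>_def h_def \<alpha>_def)
        then have eq: "2 * r * s x + r = 2 * r * (p div r) + off (lab y (p div r)) (p mod r)"
          using \<zeta>_inj mid_less[OF x] idx_less by (simp add: idx_def)
        have o: "off (lab y (p div r)) (p mod r) < 2 * r" using off_less r by simp
        have "s x = (2 * r * s x + r) div (2 * r)" using r by simp
        also have "\<dots> = p div r" unfolding eq using o r by simp
        finally have "s x = p div r" .
        then have "off (lab y (s x)) (p mod r) = r" using eq by simp
        then have "p mod r = c x y" using off_eq r lab[OF x] by simp
        then show False using False r by (metis mod_less_divisor)
      qed
      then show ?thesis using False c x y by (auto simp: incidence_colour_def antisym)
    qed
    ultimately have "uniform_bipartite_copy r N K \<chi> L R c \<alpha> \<beta> f"
      by (simp add: uniform_bipartite_copy_def)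
    then show ?thesis by blast
  qed
  then show ?thesis by blast
qed

text \<open>Two vertices of \<open>R\<close> with the same neighbours in the same colours might be identified by \<open>\<beta>\<close>. Adding to
\<open>L\<close> a private neighbour for each \<open>y \<in> R\<close> keeps them apart.\<close>

lemma coloured_bipartite_ramsey:
  fixes L :: "'a set" and R :: "'b set" and c :: "'a \<Rightarrow> 'b \<Rightarrow> nat"
  assumes L: "finite L" and R: "finite R" and r: "0 < r" and c: "\<forall>x\<in>L. \<forall>y\<in>R. c x y \<le> r"
  shows "\<exists>N K. \<forall>\<chi> :: nat \<Rightarrow> nat set \<Rightarrow> nat. (\<forall>x y. \<chi> x y < r) \<longrightarrow>
    (\<exists>\<alpha> \<beta> f. inj_on \<beta> R \<and> uniform_bipartite_copy r N K \<chi> L R c \<alpha> \<beta> f)"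
proof -
  define c' where "c' = case_sum c (\<lambda>y0 y. if y0 = y then 0 else r)"
  have "\<forall>x\<in>L <+> R. \<forall>y\<in>R. c' x y \<le> r" using c by (auto simp: c'_def)
  then obtain N K where NK: "\<And>\<chi> :: nat \<Rightarrow> nat set \<Rightarrow> nat. (\<forall>x y. \<chi> x y < r) \<Longrightarrow>
    (\<exists>\<alpha> \<beta> f. uniform_bipartite_copy r N K \<chi> (L <+> R) R c' \<alpha> \<beta> f)"
    using coloured_bipartite_ramsey_hom[of "L <+> R" r R c'] finite_Plus[OF L R] r by blast
  have "\<exists>\<alpha> \<beta> f. inj_on \<beta> R \<and> uniform_bipartite_copy r N K \<chi> L R c \<alpha> \<beta> f"
    if \<chi>: "\<forall>x y. \<chi> x y < r" for \<chi> :: "nat \<Rightarrow> nat set \<Rightarrow> nat"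
  proof -
    obtain \<alpha> \<beta> f where copy: "uniform_bipartite_copy r N K \<chi> (L <+> R) R c' \<alpha> \<beta> f"
      using NK[OF \<chi>] by blast
    then have inj: "inj_on \<alpha> (L <+> R)" and sub: "\<alpha> ` (L <+> R) \<subseteq> {..<N}"
      and rest: "\<beta> ` R \<subseteq> [{..<N}]\<^bsup>K\<^esup>" "\<forall>j<r. f j < r"
      and col: "\<And>x y. x \<in> L <+> R \<Longrightarrow> y \<in> R \<Longrightarrow> incidence_colour r (\<alpha> x) (\<beta> y) = c' x y"
      and hom: "\<And>x y. x \<in> L <+> R \<Longrightarrow> y \<in> R \<Longrightarrow> c' x y < r \<Longrightarrow> \<chi> (\<alpha> x) (\<beta> y) = f (c' x y)"
      unfolding uniform_bipartite_copy_def by blast+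
    have "inj_on \<beta> R"
    proof (rule inj_onI, rule ccontr)
      fix y y' assume y: "y \<in> R" "y' \<in> R" "\<beta> y = \<beta> y'" "y \<noteq> y'"
      have "c' (Inr y) y = c' (Inr y) y'"
        using col[OF InrI[OF y(1)] y(1)] col[OF InrI[OF y(1)] y(2)] y(3) by simp
      then show False using y(4) r by (simp add: c'_def)
    qed
    moreover have "inj_on (\<lambda>x. \<alpha> (Inl x)) L" 
      using inj by (auto simp: inj_on_def)
    moreover have "(\<lambda>x. \<alpha> (Inl x)) ` L \<subseteq> {..<N}"
      using subsetD[OF sub imageI[OF InlI]] by blast
    moreover have "incidence_colour r (\<alpha> (Inl x)) (\<beta> y) = c x y \<and>
        (c x y < r \<longrightarrow> \<chi> (\<alpha> (Inl x)) (\<beta> y) = f (c x y))" if "x \<in> L" "y \<in> R" for x y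
      using col[OF InlI[OF that(1)] that(2)] hom[OF InlI[OF that(1)] that(2)] by (simp add: c'_def)
    ultimately have "inj_on \<beta> R \<and> uniform_bipartite_copy r N K \<chi> L R c (\<lambda>x. \<alpha> (Inl x)) \<beta> f"
      using rest by (simp add: uniform_bipartite_copy_def)
    then show ?thesis by blast
  qed
  then show ?thesis by blast
qed

section \<open>The partite construction\<close>

definition partite :: "nat \<Rightarrow> 'a set \<Rightarrow> ('a \<Rightarrow> 'a \<Rightarrow> nat) \<Rightarrow> ('a \<Rightarrow> 'p) \<Rightarrow> bool" where
  "partite r V c \<pi> \<longleftrightarrow> (\<forall>u\<in>V. \<forall>v\<in>V. \<pi> u = \<pi> v \<longrightarrow> c u v = r)"

text \<open>The function \<open>f\<close> may depend on the pair \<open>(a, b)\<close> of parts. This dependence is removed at the end, by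
Ramsey's theorem for pairs of parts.\<close>

definition partite_copy :: "nat \<Rightarrow> ('p \<times> 'p) set \<Rightarrow> ('b set \<Rightarrow> nat) \<Rightarrow>
    'a set \<Rightarrow> ('a \<Rightarrow> 'a \<Rightarrow> nat) \<Rightarrow> ('a \<Rightarrow> 'p) \<Rightarrow> 'b set \<Rightarrow> ('b \<Rightarrow> 'b \<Rightarrow> nat) \<Rightarrow> ('b \<Rightarrow> 'p) \<Rightarrow>
    ('a \<Rightarrow> 'b) \<Rightarrow> bool" where
  "partite_copy r Q \<chi> V c \<pi> V' c' \<pi>' \<phi> \<longleftrightarrow>
     colour_embedding \<phi> V c V' c' \<and> (\<forall>v\<in>V. \<pi>' (\<phi> v) = \<pi> v) \<and>
     (\<forall>a b. (a, b) \<in> Q \<longrightarrow> (\<exists>f. (\<forall>j<r. f j < r) \<and>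
        (\<forall>u\<in>V. \<forall>v\<in>V. \<pi> u = a \<and> \<pi> v = b \<and> c u v < r \<longrightarrow> \<chi> {\<phi> u, \<phi> v} = f (c u v))))"

definition partite_arrow :: "nat \<Rightarrow> ('p \<times> 'p) set \<Rightarrow>
    'a set \<Rightarrow> ('a \<Rightarrow> 'a \<Rightarrow> nat) \<Rightarrow> ('a \<Rightarrow> 'p) \<Rightarrow> 'b set \<Rightarrow> ('b \<Rightarrow> 'b \<Rightarrow> nat) \<Rightarrow> ('b \<Rightarrow> 'p) \<Rightarrow> bool" where
  "partite_arrow r Q V c \<pi> V' c' \<pi>' \<longleftrightarrow>
     (\<forall>\<chi>. (\<forall>e. \<chi> e < r) \<longrightarrow> (\<exists>\<phi>. partite_copy r Q \<chi> V c \<pi> V' c' \<pi>' \<phi>))"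

text \<open>Inside a copy of \<open>V'\<close> that is good for the pairs in \<open>R\<close>, every copy of \<open>V\<close> is good for the pairs in
\<open>R\<close>, so one may look there for a copy that is good for the pairs in \<open>Q\<close> too.\<close>

lemma partite_arrow_compose:
  fixes V :: "'a set" and V' :: "'b set" and V'' :: "'c set"
  assumes 1: "partite_arrow r Q V c \<pi> V' c' \<pi>'" and 2: "partite_arrow r R V' c' \<pi>' V'' c'' \<pi>''"
  shows "partite_arrow r (Q \<union> R) V c \<pi> V'' c'' \<pi>''"
  unfolding partite_arrow_def
proof (intro allI impI)
  fix \<chi> :: "'c set \<Rightarrow> nat" assume \<chi>: "\<forall>e. \<chi> e < r"
  then obtain \<psi> where \<psi>: "partite_copy r R \<chi> V' c' \<pi>' V'' c'' \<pi>'' \<psi>"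
    using 2 unfolding partite_arrow_def by blast
  have "\<forall>e. \<chi> (\<psi> ` e) < r" using \<chi> by simp
  then obtain \<phi> where \<phi>: "partite_copy r Q (\<lambda>e. \<chi> (\<psi> ` e)) V c \<pi> V' c' \<pi>' \<phi>"
    using 1[unfolded partite_arrow_def, rule_format, of "\<lambda>e. \<chi> (\<psi> ` e)"] by blast
  have emb: "colour_embedding \<phi> V c V' c'" "colour_embedding \<psi> V' c' V'' c''"
    and parts: "\<forall>v\<in>V. \<pi>' (\<phi> v) = \<pi> v" "\<forall>v\<in>V'. \<pi>'' (\<psi> v) = \<pi>' v"
    using \<phi> \<psi> by (simp_all add: partite_copy_def)
  have V': "\<phi> v \<in> V'" if "v \<in> V" for v using emb(1) that by (auto simp: colour_embedding_def)
  have c': "c' (\<phi> u) (\<phi> v) = c u v" if "u \<in> V" "v \<in> V" for u v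
    using emb(1) that by (simp add: colour_embedding_def)
  have "\<exists>f. (\<forall>j<r. f j < r) \<and>
      (\<forall>u\<in>V. \<forall>v\<in>V. \<pi> u = a \<and> \<pi> v = b \<and> c u v < r \<longrightarrow> \<chi> {\<psi> (\<phi> u), \<psi> (\<phi> v)} = f (c u v))"
    if ab: "(a, b) \<in> Q \<union> R" for a b
  proof (cases "(a, b) \<in> Q")
    case True
    then show ?thesis using \<phi> by (simp add: partite_copy_def)
  next
    case False
    then have "(a, b) \<in> R" using ab by simp
    then have "\<exists>f. (\<forall>j<r. f j < r) \<and> (\<forall>u\<in>V'. \<forall>v\<in>V'. \<pi>' u = a \<and> \<pi>' v = b \<and>
        c' u v < r \<longrightarrow> \<chi> {\<psi> u, \<psi> v} = f (c' u v))"
      using \<psi> by (simp add: partite_copy_def)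
    then obtain f where f: "(\<forall>j<r. f j < r) \<and> (\<forall>u\<in>V'. \<forall>v\<in>V'. \<pi>' u = a \<and> \<pi>' v = b \<and>
        c' u v < r \<longrightarrow> \<chi> {\<psi> u, \<psi> v} = f (c' u v))" ..
    have "\<chi> {\<psi> (\<phi> u), \<psi> (\<phi> v)} = f (c u v)"
      if uv: "u \<in> V" "v \<in> V" and "\<pi> u = a \<and> \<pi> v = b \<and> c u v < r" for u v
      using f[THEN conjunct2, rule_format, OF V'[OF uv(1)] V'[OF uv(2)]] that parts(1) by (simp add: c')
    then show ?thesis using f[THEN conjunct1] by (intro exI[of _ f]) simp
  qed
  then have "partite_copy r (Q \<union> R) \<chi> V c \<pi> V'' c'' \<pi>'' (\<lambda>v. \<psi> (\<phi> v))"
    using parts V' colour_embedding_compose[OF emb] by (simp add: partite_copy_def)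
  then show "\<exists>\<phi>. partite_copy r (Q \<union> R) \<chi> V c \<pi> V'' c'' \<pi>'' \<phi>" by blast
qed

lemma partite_arrow_image:
  assumes "inj_on e V"
  shows "partite_arrow r {} V c \<pi> (e ` V) (image_colouring V e c) (\<lambda>x. \<pi> (inv_into V e x))"
  unfolding partite_arrow_def partite_copy_def using colour_embedding_image[OF assms] assms
  by (intro allI impI exI[of _ e]) simp

fun bipartite_colour :: "nat \<Rightarrow> nat + nat set \<Rightarrow> nat + nat set \<Rightarrow> nat" where
  "bipartite_colour r (Inl x) (Inr y) = incidence_colour r x y"
| "bipartite_colour r (Inr y) (Inl x) = incidence_colour r x y"
| "bipartite_colour r (Inl x) (Inl x') = r"
| "bipartite_colour r (Inr y) (Inr y') = r"

lemma clique_free_colouring_bipartite: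
  assumes "3 \<le> m" "0 < r"
  shows "clique_free_colouring r m (Inl ` {..<N} \<union> Inr ` [{..<N}]\<^bsup>K\<^esup>) (bipartite_colour r)"
    (is "clique_free_colouring r m ?B _")
  unfolding clique_free_colouring_def
proof (intro conjI allI impI)
  show "finite ?B" by (simp add: finite_imp_finite_nsets)
  have "incidence_colour r x y \<le> r" for x y
    using assms(2) by (simp add: incidence_colour_def less_imp_le)
  then show "\<forall>u\<in>?B. \<forall>v\<in>?B. bipartite_colour r u v \<le> r \<and> bipartite_colour r u v = bipartite_colour r v u"
    by auto
  show "\<forall>v\<in>?B. bipartite_colour r v v = r" by auto
  fix S j assume S: "S \<subseteq> ?B" "j < r" "card S = m"
  show "\<exists>u\<in>S. \<exists>v\<in>S. u \<noteq> v \<and> bipartite_colour r u v \<noteq> j"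
  proof (rule ccontr)
    assume "\<not> ?thesis"
    then have mono: "bipartite_colour r u v = j" if "u \<in> S" "v \<in> S" "u \<noteq> v" for u v
      using that by blast
    have fin: "finite S" using S assms(1) by (metis card.infinite not_numeral_le_zero)
    have "card (S \<inter> range Inl) \<le> Suc 0" "card (S \<inter> range Inr) \<le> Suc 0"
      using fin mono S(2) by (fastforce simp: card_le_Suc0_iff_eq)+
    moreover have "S = (S \<inter> range Inl) \<union> (S \<inter> range Inr)" using S(1) by auto
    then have "card S \<le> card (S \<inter> range Inl) + card (S \<inter> range Inr)"
      by (metis card_Un_le)
    ultimately show False using S(3) assms(1) by simp
  qed
qed

text \<open>The bipartite graph between the parts \<open>a\<close> and \<open>b\<close> is replaced by a bipartite host for it, and every
induced copy in the host is extended to a copy of the whole graph by a free amalgam. The copy whose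
bipartite part is found by the bipartite Ramsey theorem is the desired one.\<close>

lemma partite_step:
  fixes V :: "'a set" and \<pi> :: "'a \<Rightarrow> 'p"
  assumes m: "3 \<le> m" and r: "0 < r" and ab: "a \<noteq> b"
    and V: "clique_free_colouring r m V c" "partite r V c \<pi>"
  shows "\<exists>(V' :: ((nat + nat set) + ('a \<Rightarrow> nat + nat set) \<times> 'a) set) c' \<pi>'.
    clique_free_colouring r m V' c' \<and> partite r V' c' \<pi>' \<and> partite_arrow r {(a, b)} V c \<pi> V' c' \<pi>'"
proof -
  define L where "L = {v \<in> V. \<pi> v = a}"
  define R where "R = {v \<in> V. \<pi> v = b}"
  define U where "U = L \<union> R"
  have U: "U \<subseteq> V" by (auto simp: U_def L_def R_def)
  have fin: "finite V" and c: "\<And>u v. u \<in> V \<Longrightarrow> v \<in> V \<Longrightarrow> c u v \<le> r \<and> c u v = c v u"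
    using V(1) by (auto simp: clique_free_colouring_def)
  have "finite L" "finite R" "\<forall>x\<in>L. \<forall>y\<in>R. c x y \<le> r"
    using fin c by (auto simp: L_def R_def)
  then obtain N K where NK: "\<And>\<chi> :: nat \<Rightarrow> nat set \<Rightarrow> nat. (\<forall>x y. \<chi> x y < r) \<Longrightarrow>
    (\<exists>\<alpha> \<beta> f. inj_on \<beta> R \<and> uniform_bipartite_copy r N K \<chi> L R c \<alpha> \<beta> f)"
    using coloured_bipartite_ramsey[of L R r c] r by blast
  define B :: "(nat + nat set) set" where "B = Inl ` {..<N} \<union> Inr ` [{..<N}]\<^bsup>K\<^esup>"
  define d where "d = bipartite_colour r"
  have B: "clique_free_colouring r m B d"
    unfolding B_def d_def using m r by (rule clique_free_colouring_bipartite)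
  define \<Phi> where "\<Phi> = {\<phi> \<in> U \<rightarrow>\<^sub>E B. colour_embedding \<phi> U c B d \<and>
      (\<forall>x\<in>L. \<phi> x \<in> range Inl) \<and> (\<forall>y\<in>R. \<phi> y \<in> range Inr)}"
  have "finite (U \<rightarrow>\<^sub>E B)"
    using finite_subset[OF U fin] B by (intro finite_PiE) (auto simp: clique_free_colouring_def)
  then have \<Phi>: "finite \<Phi>" "\<And>\<phi>. \<phi> \<in> \<Phi> \<Longrightarrow> colour_embedding \<phi> U c B d" by (auto simp: \<Phi>_def)
  define A where "A = amalgam_vertices U V B \<Phi>"
  define ca where "ca = amalgam_colour r U c d"
  define \<pi>' :: "(nat + nat set) + ('a \<Rightarrow> nat + nat set) \<times> 'a \<Rightarrow> 'p"
    where "\<pi>' = case_sum (case_sum (\<lambda>_. a) (\<lambda>_. b)) (\<lambda>(\<phi>, w). \<pi> w)"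
  have "clique_free_colouring r m A ca"
    unfolding A_def ca_def using V(1) B U \<Phi> by (rule clique_free_colouring_amalgam)
  moreover have "partite r A ca \<pi>'"
    using ab V(2) unfolding partite_def A_def ca_def \<pi>'_def B_def d_def amalgam_vertices_def
    by (auto simp: U_def L_def R_def split: if_splits)
  moreover have "partite_arrow r {(a, b)} V c \<pi> A ca \<pi>'"
    unfolding partite_arrow_def
  proof (intro allI impI)
    fix \<chi> :: "((nat + nat set) + ('a \<Rightarrow> nat + nat set) \<times> 'a) set \<Rightarrow> nat"
    assume \<chi>: "\<forall>e. \<chi> e < r"
    obtain \<alpha> \<beta> f where "inj_on \<beta> R"
      and "uniform_bipartite_copy r N K (\<lambda>x y. \<chi> {Inl (Inl x), Inl (Inr y)}) L R c \<alpha> \<beta> f"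
      using NK[of "\<lambda>x y. \<chi> {Inl (Inl x), Inl (Inr y)}"] \<chi> by blast
    then have inj: "inj_on \<alpha> L" "inj_on \<beta> R"
      and sub: "\<alpha> ` L \<subseteq> {..<N}" "\<beta> ` R \<subseteq> [{..<N}]\<^bsup>K\<^esup>" and f: "\<forall>j<r. f j < r"
      and col: "\<And>x y. x \<in> L \<Longrightarrow> y \<in> R \<Longrightarrow> incidence_colour r (\<alpha> x) (\<beta> y) = c x y"
        "\<And>x y. x \<in> L \<Longrightarrow> y \<in> R \<Longrightarrow> c x y < r \<Longrightarrow> \<chi> {Inl (Inl (\<alpha> x)), Inl (Inr (\<beta> y))} = f (c x y)"
      unfolding uniform_bipartite_copy_def by blast+
    define \<phi> where "\<phi> = (\<lambda>u\<in>U. if \<pi> u = a then Inl (\<alpha> u) else Inr (\<beta> u))"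
    have \<phi>L: "\<phi> x = Inl (\<alpha> x)" if "x \<in> L" for x using that by (auto simp: \<phi>_def U_def L_def)
    have \<phi>R: "\<phi> y = Inr (\<beta> y)" if "y \<in> R" for y using that ab by (auto simp: \<phi>_def U_def R_def)
    have "inj_on \<phi> U"
    proof (rule inj_onI)
      fix u v assume uv: "u \<in> U" "v \<in> U" and eq: "\<phi> u = \<phi> v"
      consider "u \<in> L" "v \<in> L" | "u \<in> R" "v \<in> R" | "u \<in> L" "v \<in> R" | "u \<in> R" "v \<in> L"
        using uv by (auto simp: U_def)
      then show "u = v"
        using eq by cases (simp_all add: \<phi>L \<phi>R inj_onD[OF inj(1)] inj_onD[OF inj(2)])
    qed
    moreover have "\<phi> ` U \<subseteq> B"
    proof (rule image_subsetI)
      fix u assume "u \<in> U"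
      then consider "u \<in> L" | "u \<in> R" by (auto simp: U_def)
      then show "\<phi> u \<in> B"
        using sub by cases (simp_all add: \<phi>L \<phi>R B_def image_subset_iff)
    qed
    moreover have "d (\<phi> u) (\<phi> v) = c u v" if uv: "u \<in> U" "v \<in> U" for u v
    proof -
      have in_V: "u \<in> V" "v \<in> V" using uv U by auto
      consider "u \<in> L" "v \<in> L" | "u \<in> R" "v \<in> R" | "u \<in> L" "v \<in> R" | "u \<in> R" "v \<in> L"
        using uv by (auto simp: U_def)
      then show ?thesis
      proof cases
        case 1
        then have "c u v = r" using V(2) in_V by (auto simp: partite_def L_def)
        then show ?thesis using 1 by (simp add: \<phi>L d_def)
      next
        case 2
        then have "c u v = r" using V(2) in_V by (auto simp: partite_def R_def)
        then show ?thesis using 2 by (simp add: \<phi>R d_def)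
      next
        case 3
        then show ?thesis using col(1) by (simp add: \<phi>L \<phi>R d_def)
      next
        case 4
        then show ?thesis using col(1) c[OF in_V] by (simp add: \<phi>L \<phi>R d_def)
      qed
    qed
    ultimately have emb: "colour_embedding \<phi> U c B d" by (simp add: colour_embedding_def)
    have "\<phi> \<in> extensional U" by (simp add: \<phi>_def)
    then have "\<phi> \<in> U \<rightarrow>\<^sub>E B" using emb by (auto simp: PiE_def colour_embedding_def)
    then have "\<phi> \<in> \<Phi>" using emb by (simp add: \<Phi>_def \<phi>L \<phi>R)
    then have "colour_embedding (amalgam_copy U \<phi>) V c A ca"
      unfolding A_def ca_def using V(1) U emb by (intro colour_embedding_amalgam_copy)
    moreover have "\<forall>v\<in>V. \<pi>' (amalgam_copy U \<phi> v) = \<pi> v"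
      by (auto simp: amalgam_copy_def \<pi>'_def \<phi>L \<phi>R U_def) (auto simp: L_def R_def)
    moreover have "\<chi> {amalgam_copy U \<phi> u, amalgam_copy U \<phi> v} = f (c u v)"
      if "u \<in> V" "v \<in> V" "\<pi> u = a" "\<pi> v = b" "c u v < r" for u v
    proof -
      have "u \<in> L" "v \<in> R" using that by (auto simp: L_def R_def)
      then show ?thesis using col(2) that by (simp add: amalgam_copy_def U_def \<phi>L \<phi>R)
    qed
    ultimately have "partite_copy r {(a, b)} \<chi> V c \<pi> A ca \<pi>' (amalgam_copy U \<phi>)"
      using f unfolding partite_copy_def by (intro conjI allI impI exI[of _ f]) auto
    then show "\<exists>\<phi>. partite_copy r {(a, b)} \<chi> V c \<pi> A ca \<pi>' \<phi>" by blast
  qed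
  ultimately show ?thesis by blast
qed

text \<open>Each step changes the type of the vertices. Transporting the result back to \<^typ>\<open>nat\<close> makes it
possible to iterate.\<close>

lemma partite_nat_copy:
  fixes V :: "'a set"
  assumes "clique_free_colouring r m V c" "partite r V c \<pi>"
  shows "\<exists>(V' :: nat set) c' \<pi>'.
    clique_free_colouring r m V' c' \<and> partite r V' c' \<pi>' \<and> partite_arrow r {} V c \<pi> V' c' \<pi>'"
proof -
  have fin: "finite V" using assms by (simp add: clique_free_colouring_def)
  obtain e :: "'a \<Rightarrow> nat" where e: "inj_on e V"
    using finite_imp_inj_to_nat_seg[OF fin] by blast
  have "partite r (e ` V) (image_colouring V e c) (\<lambda>x. \<pi> (inv_into V e x))"
    using assms(2) e by (auto simp: partite_def image_colouring_def)
  then show ?thesis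
    using clique_free_colouring_image[OF assms(1) e] partite_arrow_image[OF e] by blast
qed

lemma partite_construction:
  fixes V :: "'a set" and Q :: "('p \<times> 'p) set"
  assumes m: "3 \<le> m" and r: "0 < r" and "finite Q" "\<forall>(a, b)\<in>Q. a \<noteq> b"
    and V: "clique_free_colouring r m V c" "partite r V c \<pi>"
  shows "\<exists>(V' :: nat set) c' \<pi>'.
    clique_free_colouring r m V' c' \<and> partite r V' c' \<pi>' \<and> partite_arrow r Q V c \<pi> V' c' \<pi>'"
  using assms(3,4)
proof (induction Q rule: finite_induct)
  case empty
  show ?case using partite_nat_copy[OF V] .
next
  case (insert p Q)
  obtain a b where p: "p = (a, b)" "a \<noteq> b" using insert.prems by (cases p) auto
  obtain V1 :: "nat set" and c1 \<pi>1 where V1: "clique_free_colouring r m V1 c1" "partite r V1 c1 \<pi>1"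
    "partite_arrow r Q V c \<pi> V1 c1 \<pi>1"
    using insert by auto
  obtain V2 :: "((nat + nat set) + (nat \<Rightarrow> nat + nat set) \<times> nat) set" and c2 \<pi>2
    where V2: "clique_free_colouring r m V2 c2" "partite r V2 c2 \<pi>2"
      "partite_arrow r {(a, b)} V1 c1 \<pi>1 V2 c2 \<pi>2"
    using partite_step[OF m r p(2) V1(1,2)] by blast
  obtain V3 :: "nat set" and c3 \<pi>3 where V3: "clique_free_colouring r m V3 c3" "partite r V3 c3 \<pi>3"
    "partite_arrow r {} V2 c2 \<pi>2 V3 c3 \<pi>3"
    using partite_nat_copy[OF V2(1,2)] by blast
  have "partite_arrow r (insert p Q) V c \<pi> V3 c3 \<pi>3"
    using partite_arrow_compose[OF partite_arrow_compose[OF V1(3) V2(3)] V3(3)] p(1) by simp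
  then show ?case using V3 by blast
qed

section \<open>A Ramsey theorem for clique-free colourings\<close>

definition uniform_copy :: "nat \<Rightarrow> ('b set \<Rightarrow> nat) \<Rightarrow> 'a set \<Rightarrow> ('a \<Rightarrow> 'a \<Rightarrow> nat) \<Rightarrow>
    'b set \<Rightarrow> ('b \<Rightarrow> 'b \<Rightarrow> nat) \<Rightarrow> ('a \<Rightarrow> 'b) \<Rightarrow> (nat \<Rightarrow> nat) \<Rightarrow> bool" where
  "uniform_copy r \<chi> V c V' c' \<phi> f \<longleftrightarrow>
     colour_embedding \<phi> V c V' c' \<and> (\<forall>j<r. f j < r) \<and>
     (\<forall>u\<in>V. \<forall>v\<in>V. c u v < r \<longrightarrow> \<chi> {\<phi> u, \<phi> v} = f (c u v))"

text \<open>Start with a disjoint union of copies of \<open>V\<close>, one for each \<open>card V\<close>-subset of the set of parts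
\<open>{..<N}\<close>, each copy having one vertex in every part of its subset. The partite construction for all pairs
of parts yields functions \<open>F a b\<close> for \<open>a < b < N\<close>. Ramsey's theorem for pairs gives a \<open>card V\<close>-subset
\<open>S\<close> of parts on which \<open>F\<close> is constant, and the copy of \<open>V\<close> over \<open>S\<close> is uniform.\<close>

theorem clique_free_colouring_ramsey:
  fixes V :: "'a set"
  assumes m: "3 \<le> m" and r: "0 < r" and V: "clique_free_colouring r m V c"
  shows "\<exists>(V' :: nat set) c'. clique_free_colouring r m V' c' \<and>
    (\<forall>\<chi>. (\<forall>e. \<chi> e < r) \<longrightarrow> (\<exists>\<phi> f. uniform_copy r \<chi> V c V' c' \<phi> f))"
proof -
  define p where "p = card V"
  have fin: "finite V" using V by (simp add: clique_free_colouring_def)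
  obtain e where e: "bij_betw e V {0..<p}"
    using ex_bij_betw_finite_nat[OF fin] unfolding p_def by blast
  have e_less: "e x < p" if "x \<in> V" for x using e that by (auto simp: bij_betw_def)
  have e_inj: "x = y" if "x \<in> V" "y \<in> V" "e x = e y" for x y
    using e that by (auto simp: bij_betw_def inj_on_def)
  define C where "C = {..<r} \<rightarrow>\<^sub>E {..<r}"
  have "finite C" unfolding C_def by (intro finite_PiE) auto
  then obtain N :: nat where N: "\<And>g. g \<in> [{..<N}]\<^bsup>2\<^esup> \<rightarrow> C \<Longrightarrow>
      \<exists>S \<in> [{..<N}]\<^bsup>p\<^esup>. \<exists>f\<in>C. \<forall>y \<in> [S]\<^bsup>2\<^esup>. g y = f"
    using ramsey_finite_colours[of C 2 p] by blast
  define I where "I = [{..<N}]\<^bsup>p\<^esup>"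
  define W where "W = Sigma I (\<lambda>_. V)"
  define d where "d = family_colour r (\<lambda>_ :: nat set. c)"
  define \<pi> where "\<pi> = (\<lambda>(S :: nat set, x). sorted_list_of_set S ! e x)"
  have W: "clique_free_colouring r m W d"
    unfolding W_def d_def using m V by (intro clique_free_colouring_family) (auto simp: I_def finite_imp_finite_nsets)
  have copy: "colour_embedding (Pair S) V c W d" if "S \<in> I" for S
    using colour_embedding_family[OF that, of "\<lambda>_. V" "\<lambda>_. c"] by (simp add: W_def d_def)
  have \<pi>_in: "\<pi> (S, x) \<in> S" if "S \<in> I" "x \<in> V" for S x
  proof -
    have "finite S" "card S = p" using that by (auto simp: I_def nsets_def)
    then show ?thesis
      using e_less[OF that(2)] nth_mem[of "e x" "sorted_list_of_set S"] by (simp add: \<pi>_def)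
  qed
  have \<pi>_inj: "x = y" if "S \<in> I" "x \<in> V" "y \<in> V" "\<pi> (S, x) = \<pi> (S, y)" for S x y
  proof -
    have "finite S" "card S = p" using that by (auto simp: I_def nsets_def)
    then have "e x = e y"
      using that e_less by (simp add: \<pi>_def nth_eq_iff_index_eq)
    then show ?thesis using e_inj that by blast
  qed
  have c_irrefl: "c x x = r" if "x \<in> V" for x using V that by (simp add: clique_free_colouring_def)
  have c_sym: "c x y = c y x" if "x \<in> V" "y \<in> V" for x y
    using V that by (simp add: clique_free_colouring_def)
  have "partite r W d \<pi>"
    unfolding partite_def
  proof (intro ballI impI)
    fix u v assume "u \<in> W" "v \<in> W" and eq: "\<pi> u = \<pi> v"
    then obtain S x T y where uv: "u = (S, x)" "v = (T, y)" "S \<in> I" "T \<in> I" "x \<in> V" "y \<in> V"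
      by (auto simp: W_def)
    show "d u v = r"
    proof (cases "S = T")
      case True
      then have "x = y" using \<pi>_inj uv eq by blast
      then show ?thesis using uv True c_irrefl by (simp add: d_def family_colour_def)
    next
      case False
      then show ?thesis using uv by (simp add: d_def family_colour_def)
    qed
  qed
  moreover define Q where "Q = {(a, b). a < b \<and> b < N}"
  have "Q \<subseteq> {..<N} \<times> {..<N}" by (auto simp: Q_def)
  then have "finite Q" by (rule finite_subset) simp
  moreover have "\<forall>(a, b)\<in>Q. a \<noteq> b" by (auto simp: Q_def)
  ultimately obtain V' :: "nat set" and c' \<pi>' where V': "clique_free_colouring r m V' c'"
    and arrow: "partite_arrow r Q W d \<pi> V' c' \<pi>'"
    using partite_construction[OF m r _ _ W] by blast
  have "\<exists>\<phi> f. uniform_copy r \<chi> V c V' c' \<phi> f" if \<chi>: "\<forall>e. \<chi> e < r" for \<chi>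
  proof -
    obtain \<phi> where \<phi>: "partite_copy r Q \<chi> W d \<pi> V' c' \<pi>' \<phi>"
      using arrow \<chi> unfolding partite_arrow_def by blast
    have "\<forall>a b. \<exists>f. (a, b) \<in> Q \<longrightarrow> (\<forall>j<r. f j < r) \<and>
        (\<forall>u\<in>W. \<forall>v\<in>W. \<pi> u = a \<and> \<pi> v = b \<and> d u v < r \<longrightarrow> \<chi> {\<phi> u, \<phi> v} = f (d u v))"
      using \<phi> by (simp add: partite_copy_def)
    then obtain F where F: "\<And>a b. (a, b) \<in> Q \<Longrightarrow> (\<forall>j<r. F a b j < r) \<and>
        (\<forall>u\<in>W. \<forall>v\<in>W. \<pi> u = a \<and> \<pi> v = b \<and> d u v < r \<longrightarrow> \<chi> {\<phi> u, \<phi> v} = F a b (d u v))"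
      by metis
    define g where "g = (\<lambda>y. restrict (F (Min y) (Max y)) {..<r})"
    have "g \<in> [{..<N}]\<^bsup>2\<^esup> \<rightarrow> C"
    proof
      fix y assume "y \<in> [{..<N}]\<^bsup>2\<^esup>"
      then obtain a b where "y = {a, b}" "a < b" "b < N"
        by (auto simp: ordered_nsets_2_eq)
      then have "g y = restrict (F a b) {..<r}" "(a, b) \<in> Q" by (auto simp: g_def Q_def)
      then show "g y \<in> C" using F by (auto simp: C_def)
    qed
    then obtain S f where S: "S \<in> I" and f: "f \<in> C" and gf: "\<And>y. y \<in> [S]\<^bsup>2\<^esup> \<Longrightarrow> g y = f"
      using N unfolding I_def by blast
    have SN: "S \<subseteq> {..<N}" using S by (auto simp: I_def nsets_def)
    have less: "\<chi> {\<phi> (S, u), \<phi> (S, v)} = f (c u v)"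
      if uv: "u \<in> V" "v \<in> V" and col: "c u v < r" and lt: "\<pi> (S, u) < \<pi> (S, v)" for u v
    proof -
      have in_S: "\<pi> (S, u) \<in> S" "\<pi> (S, v) \<in> S" using \<pi>_in S uv by auto
      then have "{\<pi> (S, u), \<pi> (S, v)} \<in> [S]\<^bsup>2\<^esup>" using lt by auto
      then have "f (c u v) = F (\<pi> (S, u)) (\<pi> (S, v)) (c u v)"
        using gf[of "{\<pi> (S, u), \<pi> (S, v)}"] lt col by (auto simp: g_def)
      moreover have "(\<pi> (S, u), \<pi> (S, v)) \<in> Q" using lt in_S SN by (auto simp: Q_def)
      moreover have "(S, u) \<in> W" "(S, v) \<in> W" "d (S, u) (S, v) = c u v"
        using uv S by (auto simp: W_def d_def family_colour_def)
      ultimately show ?thesis using F[of "\<pi> (S, u)" "\<pi> (S, v)"] col by auto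
    qed
    have "\<chi> {\<phi> (S, u), \<phi> (S, v)} = f (c u v)" if uv: "u \<in> V" "v \<in> V" and col: "c u v < r" for u v
    proof -
      have "u \<noteq> v" using col c_irrefl uv by auto
      then have "\<pi> (S, u) \<noteq> \<pi> (S, v)" using \<pi>_inj S uv by blast
      then consider "\<pi> (S, u) < \<pi> (S, v)" | "\<pi> (S, v) < \<pi> (S, u)" by linarith
      then show ?thesis
      proof cases
        case 1
        then show ?thesis using less uv col by blast
      next
        case 2
        then show ?thesis using less[OF uv(2,1)] col c_sym[OF uv] by (simp add: insert_commute)
      qed
    qed
    moreover have "colour_embedding \<phi> W d V' c'" using \<phi> by (simp add: partite_copy_def)
    then have "colour_embedding (\<lambda>x. \<phi> (S, x)) V c V' c'"
      by (rule colour_embedding_compose[OF copy[OF S]])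
    moreover have "\<forall>j<r. f j < r" using f by (auto simp: C_def)
    ultimately have "uniform_copy r \<chi> V c V' c' (\<lambda>x. \<phi> (S, x)) f"
      by (simp add: uniform_copy_def)
    then show ?thesis by blast
  qed
  then show ?thesis using V' by blast
qed

section \<open>From dense colourings to minimal Ramsey graphs\<close>

lemma ramsey_for_complete_graph_iff:
  assumes "0 < m"
  shows "ramsey_for r G (complete_graph m) \<longleftrightarrow>
    (\<forall>c \<in> edges G \<rightarrow> {..<r}. \<exists>i<r. \<exists>Q\<subseteq>vertices G. card Q = m \<and>
       (\<forall>u\<in>Q. \<forall>v\<in>Q. u \<noteq> v \<longrightarrow> {u, v} \<in> edges G \<and> c {u, v} = i))" (is "_ = ?R")
proof
  assume L: "ramsey_for r G (complete_graph m)"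
  show ?R
  proof
    fix c assume "c \<in> edges G \<rightarrow> {..<r}"
    then obtain i \<phi> where i: "i < r" and \<phi>: "embedding \<phi> (complete_graph m) G"
      and col: "\<forall>e \<in> edges (complete_graph m). c (\<phi> ` e) = i"
      using L unfolding ramsey_for_def by blast
    have inj: "inj_on \<phi> {..<m}" and sub: "\<phi> ` {..<m} \<subseteq> vertices G"
      and edge: "\<And>e. e \<in> [{..<m}]\<^bsup>2\<^esup> \<Longrightarrow> \<phi> ` e \<in> edges G \<and> c (\<phi> ` e) = i"
      using \<phi> col by (auto simp: embedding_def complete_graph_def)
    have "{\<phi> u, \<phi> v} \<in> edges G \<and> c {\<phi> u, \<phi> v} = i"
      if "u < m" "v < m" "\<phi> u \<noteq> \<phi> v" for u v
    proof -
      have "{u, v} \<in> [{..<m}]\<^bsup>2\<^esup>" using that by auto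
      from edge[OF this] show ?thesis by simp
    qed
    then have "\<forall>u\<in>\<phi> ` {..<m}. \<forall>v\<in>\<phi> ` {..<m}. u \<noteq> v \<longrightarrow> {u, v} \<in> edges G \<and> c {u, v} = i"
      by auto
    moreover have "card (\<phi> ` {..<m}) = m" using inj by (simp add: card_image)
    ultimately show "\<exists>i<r. \<exists>Q\<subseteq>vertices G. card Q = m \<and>
       (\<forall>u\<in>Q. \<forall>v\<in>Q. u \<noteq> v \<longrightarrow> {u, v} \<in> edges G \<and> c {u, v} = i)"
      using i sub by blast
  qed
next
  assume R: ?R
  show "ramsey_for r G (complete_graph m)"
    unfolding ramsey_for_def
  proof
    fix c assume c: "c \<in> edges G \<rightarrow> {..<r}"
    obtain i Q where i: "i < r" and Q: "Q \<subseteq> vertices G" "card Q = m"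
      and "\<forall>u\<in>Q. \<forall>v\<in>Q. u \<noteq> v \<longrightarrow> {u, v} \<in> edges G \<and> c {u, v} = i"
      using bspec[OF R c] by blast
    then have col: "{u, v} \<in> edges G \<and> c {u, v} = i" if "u \<in> Q" "v \<in> Q" "u \<noteq> v" for u v
      using that by simp
    have "finite Q" using Q(2) assms card_gt_0_iff by blast
    then obtain \<phi> where \<phi>: "bij_betw \<phi> {0..<m} Q"
      using ex_bij_betw_nat_finite Q(2) by blast
    have "\<phi> ` e \<in> edges G \<and> c (\<phi> ` e) = i" if e: "e \<in> [{..<m}]\<^bsup>2\<^esup>" for e
    proof -
      obtain x y where xy: "e = {x, y}" "x < m" "y < m" "x \<noteq> y"
        using e by (auto simp: nsets_2_eq)
      then have "\<phi> x \<in> Q" "\<phi> y \<in> Q" "\<phi> x \<noteq> \<phi> y"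
        using \<phi> by (auto simp: bij_betw_def inj_on_def)
      from col[OF this] show ?thesis using xy by simp
    qed
    then have "embedding \<phi> (complete_graph m) G \<and> (\<forall>e \<in> edges (complete_graph m). c (\<phi> ` e) = i)"
      using \<phi> Q(1) by (auto simp: embedding_def complete_graph_def bij_betw_def atLeast0LessThan)
    then show "\<exists>i<r. \<exists>\<phi>. embedding \<phi> (complete_graph m) G \<and> (\<forall>e \<in> edges (complete_graph m). c (\<phi> ` e) = i)"
      using i by blast
  qed
qed

text \<open>A clique that becomes monochromatic as soon as a recolouring identifies \<open>i\<close> and \<open>j\<close>.\<close>

definition two_coloured_clique :: "nat \<Rightarrow> nat \<Rightarrow> nat \<Rightarrow> nat \<Rightarrow> nat \<Rightarrow> nat" where
  "two_coloured_clique r i j = (\<lambda>u v. if u = v then r else if {u, v} = {0, 1} then i else j)"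

lemma clique_free_two_coloured_clique:
  assumes "3 \<le> m" "i < r" "j < r" "i \<noteq> j"
  shows "clique_free_colouring r m {..<m} (two_coloured_clique r i j)"
  unfolding clique_free_colouring_def
proof (intro conjI allI impI)
  fix S a assume S: "S \<subseteq> {..<m}" "a < r" "card S = m"
  then have "S = {..<m}" by (intro card_subset_eq) auto
  then have "0 \<in> S" "1 \<in> S" "2 \<in> S" using assms(1) by auto
  moreover have "two_coloured_clique r i j 0 1 = i" "two_coloured_clique r i j 0 2 = j"
    by (auto simp: two_coloured_clique_def doubleton_eq_iff)
  ultimately show "\<exists>u\<in>S. \<exists>v\<in>S. u \<noteq> v \<and> two_coloured_clique r i j u v \<noteq> a"
    using assms(4) by (metis zero_neq_one zero_neq_numeral)
qed (use assms in \<open>auto simp: two_coloured_clique_def insert_commute\<close>)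

text \<open>A recolouring of \<open>d\<close> through a function \<open>f\<close> of the colours creates a monochromatic \<open>m\<close>-clique unless
\<open>f\<close> is injective.\<close>

definition separates_colours :: "nat \<Rightarrow> nat \<Rightarrow> 'a set \<Rightarrow> ('a \<Rightarrow> 'a \<Rightarrow> nat) \<Rightarrow> bool" where
  "separates_colours r m V d \<longleftrightarrow> (\<forall>i<r. \<forall>j<r. i \<noteq> j \<longrightarrow>
     (\<exists>T\<subseteq>V. card T = m \<and> (\<forall>u\<in>T. \<forall>v\<in>T. u \<noteq> v \<longrightarrow> d u v = i \<or> d u v = j)))"

lemma exists_separating_extension:
  fixes P :: "'a set"
  assumes m: "3 \<le> m" and P: "clique_free_colouring r m P c"
  shows "\<exists>(V :: ((nat \<times> nat) \<times> nat) set) d \<phi>.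
    clique_free_colouring r m V d \<and> colour_embedding \<phi> P c V d \<and>
    separates_colours r m V d"
proof -
  have fin: "finite P" using P by (simp add: clique_free_colouring_def)
  obtain e :: "'a \<Rightarrow> nat" where e: "inj_on e P"
    using finite_imp_inj_to_nat_seg[OF fin] by blast
  \<comment> \<open>the index \<open>(0, 0)\<close> is free to carry \<open>P\<close>, since the cliques use pairs with different entries\<close>
  define I where "I = insert (0, 0) {(i, j). i < r \<and> j < r \<and> i \<noteq> j}"
  have "I \<subseteq> insert (0, 0) ({..<r} \<times> {..<r})" by (auto simp: I_def)
  then have I: "finite I" by (rule finite_subset) simp
  define V where "V p = (if p = (0, 0) then e ` P else {..<m})" for p :: "nat \<times> nat"
  define C where "C p = (if p = (0, 0) then image_colouring P e c
      else two_coloured_clique r (fst p) (snd p))" for p :: "nat \<times> nat"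
  have "clique_free_colouring r m (V p) (C p)" if "p \<in> I" for p
    using that clique_free_colouring_image[OF P e] clique_free_two_coloured_clique[OF m]
    by (auto simp: V_def C_def I_def)
  then have "clique_free_colouring r m (Sigma I V) (family_colour r C)"
    using m I by (intro clique_free_colouring_family) auto
  moreover have "(0, 0) \<in> I" by (simp add: I_def)
  from colour_embedding_family[OF this, of V C r]
  have "colour_embedding (Pair (0, 0)) (e ` P) (image_colouring P e c) (Sigma I V) (family_colour r C)"
    by (simp add: V_def C_def)
  then have "colour_embedding (\<lambda>x. ((0, 0), e x)) P c (Sigma I V) (family_colour r C)"
    by (rule colour_embedding_compose[OF colour_embedding_image[OF e]])
  moreover have "\<exists>T\<subseteq>Sigma I V. card T = m \<and>
      (\<forall>u\<in>T. \<forall>v\<in>T. u \<noteq> v \<longrightarrow> family_colour r C u v = i \<or> family_colour r C u v = j)"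
    if ij: "i < r" "j < r" "i \<noteq> j" for i j
  proof (intro exI conjI)
    show "Pair (i, j) ` {..<m} \<subseteq> Sigma I V" using ij by (auto simp: I_def V_def)
    show "card (Pair (i, j) ` {..<m}) = m" by (simp add: card_image inj_on_def)
    show "\<forall>u\<in>Pair (i, j) ` {..<m}. \<forall>v\<in>Pair (i, j) ` {..<m}. u \<noteq> v \<longrightarrow>
        family_colour r C u v = i \<or> family_colour r C u v = j"
      using ij by (auto simp: family_colour_def C_def two_coloured_clique_def)
  qed
  then have "separates_colours r m (Sigma I V) (family_colour r C)"
    by (simp add: separates_colours_def)
  ultimately show ?thesis by blast
qed

text \<open>The graph \<open>G\<close> consists of the host \<open>H\<close> of the Ramsey theorem for \<open>P\<close> and, for each \<open>card P\<close>-subset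
\<open>S\<close> of \<open>H\<close>, a new vertex \<open>z S\<close> joined to \<open>S\<close>. Colouring \<open>H\<close> by \<open>h\<close> shows that a Ramsey subgraph of
\<open>G\<close> needs one of the new vertices, whose degree is at most \<open>card P\<close>.\<close>

theorem smallest_min_degree_le_card:
  fixes P :: "'a set"
  assumes k: "2 \<le> k" and r: "0 < r" and P: "clique_free_colouring r (k + 1) P c"
    and dense: "\<And>W j. W \<subseteq> P \<Longrightarrow> card P \<le> r * card W \<Longrightarrow> j < r \<Longrightarrow>
      \<exists>K\<subseteq>W. card K = k \<and> (\<forall>u\<in>K. \<forall>v\<in>K. u \<noteq> v \<longrightarrow> c u v = j)"
  shows "smallest_min_degree r (complete_graph (k + 1)) \<le> card P"
proof -
  have m: "3 \<le> k + 1" "0 < k + 1" using k by simp_all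
  have finP: "finite P" using P by (simp add: clique_free_colouring_def)
  obtain V :: "((nat \<times> nat) \<times> nat) set" and d \<iota>
    where V: "clique_free_colouring r (k + 1) V d" and \<iota>: "colour_embedding \<iota> P c V d"
      and sep: "separates_colours r (k + 1) V d"
    using exists_separating_extension[OF m(1) P] by blast
  obtain H :: "nat set" and h where H: "clique_free_colouring r (k + 1) H h"
    and arrow: "\<And>\<chi>. (\<forall>e. \<chi> e < r) \<Longrightarrow> \<exists>\<phi> f. uniform_copy r \<chi> V d H h \<phi> f"
    using clique_free_colouring_ramsey[OF m(1) r V] by blast
  have finH: "finite H" and h_sym: "\<And>u v. u \<in> H \<Longrightarrow> v \<in> H \<Longrightarrow> h u v = h v u"
    and h_irrefl: "\<And>v. v \<in> H \<Longrightarrow> h v v = r"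
    using H by (auto simp: clique_free_colouring_def)
  obtain M where M: "H \<subseteq> {..<M}" using finH finite_nat_iff_bounded by auto
  define \<S> where "\<S> = {S. S \<subseteq> H \<and> card S = card P}"
  \<comment> \<open>adding the bound \<open>M\<close> makes the codes of the new vertices differ from all vertices of \<open>H\<close>\<close>
  define z where "z S = M + set_encode S" for S
  have fin\<S>: "finite \<S>" "\<And>S. S \<in> \<S> \<Longrightarrow> finite S"
    using finH finite_subset[of _ H] by (auto simp: \<S>_def intro: finite_subset[of _ "Pow H"])
  have z_inj: "S = T" if "S \<in> \<S>" "T \<in> \<S>" "z S = z T" for S T
    using that fin\<S>(2) set_encode_eq by (simp add: z_def)
  have z_notin: "z S \<notin> H" for S using M by (auto simp: z_def)
  define E0 where "E0 = {{u, v} | u v. u \<in> H \<and> v \<in> H \<and> h u v < r}"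
  define E1 where "E1 = {{z S, x} | S x. S \<in> \<S> \<and> x \<in> S}"
  define G where "G = (H \<union> z ` \<S>, E0 \<union> E1)"
  have \<S>_H: "x \<in> H" if "S \<in> \<S>" "x \<in> S" for S x using that by (auto simp: \<S>_def)
  have edge0: "{u, v} \<in> [vertices G]\<^bsup>2\<^esup>" if "u \<in> H" "v \<in> H" "h u v < r" for u v
    using that h_irrefl by (auto simp: G_def)
  have edge1: "{z S, x} \<in> [vertices G]\<^bsup>2\<^esup>" if "S \<in> \<S>" "x \<in> S" for S x
    using that \<S>_H[OF that] z_notin[of S] by (auto simp: G_def)
  have "edges G \<subseteq> [vertices G]\<^bsup>2\<^esup>"
    using edge0 edge1 by (auto simp: G_def E0_def E1_def simp del: doubleton_in_nsets_2)
  then have simple: "finite_simple_graph G"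
    using finH fin\<S> by (simp add: finite_simple_graph_def G_def)
  have "ramsey_for r G (complete_graph (k + 1))"
    unfolding ramsey_for_complete_graph_iff[OF m(2)]
  proof (rule ballI, rule ccontr)
    fix col assume col: "col \<in> edges G \<rightarrow> {..<r}"
    assume neg: "\<not> (\<exists>i<r. \<exists>Q\<subseteq>vertices G. card Q = k + 1 \<and>
       (\<forall>u\<in>Q. \<forall>v\<in>Q. u \<noteq> v \<longrightarrow> {u, v} \<in> edges G \<and> col {u, v} = i))"
    have no_mono: False if "i < r" "Q \<subseteq> vertices G" "card Q = k + 1"
      "\<And>u v. u \<in> Q \<Longrightarrow> v \<in> Q \<Longrightarrow> u \<noteq> v \<Longrightarrow> {u, v} \<in> edges G \<and> col {u, v} = i" for i Q
      using neg that by blast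
    define \<chi> where "\<chi> e = (if e \<in> edges G then col e else 0)" for e
    have "\<forall>e. \<chi> e < r" using col r by (auto simp: \<chi>_def)
    then obtain \<phi> f where "uniform_copy r \<chi> V d H h \<phi> f" using arrow by blast
    then have \<phi>: "colour_embedding \<phi> V d H h" and f: "\<And>j. j < r \<Longrightarrow> f j < r"
      and hom: "\<And>u v. u \<in> V \<Longrightarrow> v \<in> V \<Longrightarrow> d u v < r \<Longrightarrow> \<chi> {\<phi> u, \<phi> v} = f (d u v)"
      by (auto simp: uniform_copy_def)
    have \<phi>H: "\<phi> u \<in> H" if "u \<in> V" for u using \<phi> that by (auto simp: colour_embedding_def)
    have \<phi>_col: "{\<phi> u, \<phi> v} \<in> edges G \<and> col {\<phi> u, \<phi> v} = f (d u v)"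
      if uv: "u \<in> V" "v \<in> V" "d u v < r" for u v
    proof -
      have "h (\<phi> u) (\<phi> v) = d u v" using \<phi> uv by (simp add: colour_embedding_def)
      then have "{\<phi> u, \<phi> v} \<in> E0"
        unfolding E0_def using \<phi>H[OF uv(1)] \<phi>H[OF uv(2)] uv(3) by force
      then have "{\<phi> u, \<phi> v} \<in> edges G" by (simp add: G_def)
      then show ?thesis using hom[OF uv] by (simp add: \<chi>_def)
    qed
    have \<phi>_inj: "inj_on \<phi> V" using \<phi> by (simp add: colour_embedding_def)
    have H_G: "H \<subseteq> vertices G" by (simp add: G_def)
    \<comment> \<open>if \<open>f i = f j\<close>, the copy of the clique with the two colours \<open>i\<close> and \<open>j\<close> is monochromatic\<close>
    have "inj_on f {..<r}"
    proof (rule inj_onI, rule ccontr)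
      fix i j assume ij: "i \<in> {..<r}" "j \<in> {..<r}" "f i = f j" "i \<noteq> j"
      have "\<exists>T\<subseteq>V. card T = k + 1 \<and> (\<forall>u\<in>T. \<forall>v\<in>T. u \<noteq> v \<longrightarrow> d u v = i \<or> d u v = j)"
        using sep[unfolded separates_colours_def, rule_format, of i j] ij by simp
      then obtain T where T: "T \<subseteq> V" "card T = k + 1"
        and dT: "\<forall>u\<in>T. \<forall>v\<in>T. u \<noteq> v \<longrightarrow> d u v = i \<or> d u v = j"
        by blast
      show False
      proof (rule no_mono[of "f i" "\<phi> ` T"])
        show "f i < r" using f ij(1) by simp
        show "\<phi> ` T \<subseteq> vertices G" using \<phi>H[OF subsetD[OF T(1)]] H_G by blast
        show "card (\<phi> ` T) = k + 1" using card_image[OF inj_on_subset[OF \<phi>_inj T(1)]] T(2) by simp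
        fix x y assume "x \<in> \<phi> ` T" "y \<in> \<phi> ` T" "x \<noteq> y"
        then obtain u v where uv: "x = \<phi> u" "y = \<phi> v" "u \<in> T" "v \<in> T" "u \<noteq> v" by blast
        have "d u v = i \<or> d u v = j" using dT uv(3-5) by blast
        then have "d u v < r" "f (d u v) = f i" using ij by auto
        then show "{x, y} \<in> edges G \<and> col {x, y} = f i"
          using \<phi>_col[OF subsetD[OF T(1) uv(3)] subsetD[OF T(1) uv(4)]] uv(1,2) by simp
      qed
    qed
    moreover have "f ` {..<r} \<subseteq> {..<r}" using f by auto
    ultimately have f_surj: "f ` {..<r} = {..<r}" by (intro endo_inj_surj) auto
    have emb: "colour_embedding (\<lambda>x. \<phi> (\<iota> x)) P c H h"
      by (rule colour_embedding_compose[OF \<iota> \<phi>])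
    define g where "g = (\<lambda>x. \<phi> (\<iota> x))"
    have g_inj: "inj_on g P" and gH: "g ` P \<subseteq> H"
      using emb unfolding colour_embedding_def g_def by blast+
    define S where "S = g ` P"
    have S: "S \<in> \<S>" using g_inj gH by (simp add: \<S>_def S_def card_image)
    have star: "{z S, g x} \<in> edges G" if "x \<in> P" for x
      using S that by (auto simp: G_def E1_def S_def)
    have "(\<lambda>x. col {z S, g x}) \<in> P \<rightarrow> {..<r}" using star col by auto
    then obtain a where a: "a < r" and "card P \<le> r * card {x \<in> P. col {z S, g x} = a}"
      using pigeonhole_average[of P "{..<r}" "\<lambda>x. col {z S, g x}"] finP r by auto
    moreover obtain j where j: "j < r" "f j = a" using a f_surj by (metis imageE lessThan_iff)
    ultimately obtain K where K: "K \<subseteq> {x \<in> P. col {z S, g x} = a}" "card K = k"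
      and cK: "\<And>u v. u \<in> K \<Longrightarrow> v \<in> K \<Longrightarrow> u \<noteq> v \<Longrightarrow> c u v = j"
      using dense[of "{x \<in> P. col {z S, g x} = a}" j] by auto
    have KP: "K \<subseteq> P" using K(1) by auto
    have z_new: "z S \<notin> g ` K" using z_notin gH KP by blast
    have inner: "{g u, g v} \<in> edges G \<and> col {g u, g v} = a" if uv: "u \<in> K" "v \<in> K" "u \<noteq> v" for u v
    proof -
      have "u \<in> P" "v \<in> P" using uv KP by auto
      then have "\<iota> u \<in> V" "\<iota> v \<in> V" "d (\<iota> u) (\<iota> v) = c u v"
        using \<iota> by (auto simp: colour_embedding_def)
      then show ?thesis using \<phi>_col[of "\<iota> u" "\<iota> v"] cK[OF uv] j by (simp add: g_def)
    qed
    have outer: "{z S, g u} \<in> edges G \<and> col {z S, g u} = a" if "u \<in> K" for u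
      using star that K(1) by auto
    show False
    proof (rule no_mono[of a "insert (z S) (g ` K)"])
      show "a < r" by (rule a)
      show "insert (z S) (g ` K) \<subseteq> vertices G" using S gH KP by (auto simp: G_def)
      have "card (g ` K) = k" using card_image[OF inj_on_subset[OF g_inj KP]] K(2) by simp
      then show "card (insert (z S) (g ` K)) = k + 1"
        using z_new finite_subset[OF KP finP] by simp
      fix x y assume "x \<in> insert (z S) (g ` K)" "y \<in> insert (z S) (g ` K)" "x \<noteq> y"
      then consider u where "x = z S" "y = g u" "u \<in> K" | u where "y = z S" "x = g u" "u \<in> K"
        | u v where "x = g u" "y = g v" "u \<in> K" "v \<in> K" "u \<noteq> v" by auto
      then show "{x, y} \<in> edges G \<and> col {x, y} = a"
      proof cases
        case 1
        then show ?thesis using outer by simp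
      next
        case 2
        then show ?thesis using outer by (simp add: insert_commute)
      next
        case 3
        then show ?thesis using inner by simp
      qed
    qed
  qed
  then obtain G' where sub: "subgraph G' G" and min: "ramsey_minimal_for r G' (complete_graph (k + 1))"
    using ramsey_minimal_subgraph_exists[OF simple] by blast
  have G': "finite (vertices G')" "edges G' \<subseteq> [vertices G']\<^bsup>2\<^esup>"
    "vertices G' \<subseteq> H \<union> z ` \<S>" "edges G' \<subseteq> E0 \<union> E1"
    using sub by (auto simp: subgraph_def finite_simple_graph_def G_def)
  have "\<exists>S\<in>\<S>. z S \<in> vertices G'"
  proof (rule ccontr)
    assume "\<not> ?thesis"
    then have in_H: "vertices G' \<subseteq> H" using G'(3) by blast
    have edge_h: "h u v < r" if uv: "{u, v} \<in> edges G'" "u \<in> H" "v \<in> H" for u v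
    proof -
      have "{u, v} \<notin> E1" using uv z_notin by (auto simp: E1_def doubleton_eq_iff)
      then have "{u, v} \<in> E0" using uv(1) G'(4) by blast
      then show ?thesis using h_sym by (auto simp: E0_def doubleton_eq_iff)
    qed
    \<comment> \<open>the colouring \<open>h\<close>, read as a function of edges, refutes that \<open>G'\<close> is Ramsey\<close>
    have "(\<lambda>e. h (Min e) (Max e)) \<in> edges G' \<rightarrow> {..<r}"
    proof
      fix e assume e: "e \<in> edges G'"
      then obtain a b where ab: "e = {a, b}" "a \<in> H" "b \<in> H" "a < b"
        using G'(2) in_H unfolding ordered_nsets_2_eq by blast
      then show "h (Min e) (Max e) \<in> {..<r}" using edge_h e by (simp add: min_def max_def)
    qed
    moreover have "ramsey_for r G' (complete_graph (k + 1))"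
      using min by (simp add: ramsey_minimal_for_def)
    ultimately obtain i Q where i: "i < r" and Q: "Q \<subseteq> vertices G'" "card Q = k + 1"
      and mono: "\<forall>u\<in>Q. \<forall>v\<in>Q. u \<noteq> v \<longrightarrow> {u, v} \<in> edges G' \<and> h (Min {u, v}) (Max {u, v}) = i"
      unfolding ramsey_for_complete_graph_iff[OF m(2)] by meson
    have "Q \<subseteq> H" using Q(1) in_H by blast
    then obtain u v where uv: "u \<in> Q" "v \<in> Q" "u \<noteq> v" "h u v \<noteq> i"
      using H i Q(2) unfolding clique_free_colouring_def by blast
    have "h (Min {u, v}) (Max {u, v}) = h u v"
      using h_sym uv \<open>Q \<subseteq> H\<close> by (cases "u \<le> v") (auto simp: min_def max_def)
    then show False using mono uv by auto
  qed
  then obtain S where S: "S \<in> \<S>" "z S \<in> vertices G'" by blast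
  have "{e \<in> edges G'. z S \<in> e} \<subseteq> (\<lambda>x. {z S, x}) ` S"
  proof
    fix e assume "e \<in> {e \<in> edges G'. z S \<in> e}"
    then have e: "e \<in> E0 \<union> E1" "z S \<in> e" using G'(4) by auto
    then have "e \<notin> E0" using z_notin by (auto simp: E0_def)
    then obtain T x where T: "e = {z T, x}" "T \<in> \<S>" "x \<in> T" using e(1) by (auto simp: E1_def)
    then have "z S = z T" using e(2) \<S>_H z_notin by auto
    then have "S = T" using z_inj S(1) T(2) by blast
    then show "e \<in> (\<lambda>x. {z S, x}) ` S" using T by blast
  qed
  then have "degree G' (z S) \<le> card ((\<lambda>x. {z S, x}) ` S)"
    unfolding degree_def using fin\<S>(2)[OF S(1)] by (intro card_mono) auto
  also have "\<dots> \<le> card S" using fin\<S>(2)[OF S(1)] by (rule card_image_le)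
  also have "\<dots> = card P" using S(1) by (simp add: \<S>_def)
  finally have deg: "degree G' (z S) \<le> card P" .
  have "min_degree G' \<le> degree G' (z S)"
    unfolding min_degree_def using S(2) G'(1) by (intro Min_le) auto
  moreover have "smallest_min_degree r (complete_graph (k + 1)) \<le> min_degree G'"
    unfolding smallest_min_degree_def
    using min by (intro Least_le imageI) (simp add: ramsey_minimal_graphs_def)
  ultimately show ?thesis using deg by linarith
qed

section \<open>Random partitions of lines\<close>

text \<open>The union bound over the missed value: a random function to \<open>{..<k}\<close> avoids a given value on \<open>D\<close> with
probability \<open>(1 - 1 / k) ^ card D\<close>.\<close>

lemma card_functions_missing_value:
  assumes "finite P" "D \<subseteq> P" "0 < k"
  shows "real (card {g \<in> P \<rightarrow>\<^sub>E {..<k}. g ` D \<noteq> {..<k}})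
           \<le> real k ^ card P * (real k * (1 - 1 / real k) ^ card D)"
proof -
  define miss where "miss j = (P \<rightarrow>\<^sub>E {..<k}) \<inter> {g. j \<notin> g ` D}" for j
  have fin: "finite (miss j)" for j
    unfolding miss_def using assms(1) by (intro finite_Int disjI1 finite_PiE) auto
  have miss: "real (card (miss j)) = real k ^ card P * (1 - 1 / real k) ^ card D" if "j < k" for j
  proof -
    have "miss j = (\<Pi>\<^sub>E p\<in>P. if p \<in> D then {..<k} - {j} else {..<k})"
      unfolding miss_def using assms(2) by (fastforce simp: PiE_iff split: if_splits)
    then have "card (miss j) = (\<Prod>p\<in>P. if p \<in> D then k - 1 else k)"
      using assms(1) that by (simp add: card_PiE if_distrib cong: if_cong)
    also have "\<dots> = (k - 1) ^ card D * k ^ card (P - D)"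
      using assms(1,2) by (simp add: prod.If_cases Int_absorb1 Diff_eq)
    finally have "real (card (miss j)) = real (k - 1) ^ card D * real k ^ card (P - D)" by simp
    also have "real (k - 1) = real k * (1 - 1 / real k)"
      using assms(3) by (simp add: field_simps of_nat_diff)
    also have "(real k * (1 - 1 / real k)) ^ card D * real k ^ card (P - D)
        = real k ^ (card D + card (P - D)) * (1 - 1 / real k) ^ card D"
      by (simp add: power_mult_distrib power_add mult_ac)
    also have "card D + card (P - D) = card P"
      using assms(1,2) by (simp add: card_Diff_subset finite_subset card_mono)
    finally show ?thesis .
  qed
  have "{g \<in> P \<rightarrow>\<^sub>E {..<k}. g ` D \<noteq> {..<k}} \<subseteq> (\<Union>j<k. miss j)"
    using assms(2) by (fastforce simp: miss_def PiE_iff)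
  then have "card {g \<in> P \<rightarrow>\<^sub>E {..<k}. g ` D \<noteq> {..<k}} \<le> card (\<Union>j<k. miss j)"
    using fin by (intro card_mono) auto
  also have "\<dots> \<le> (\<Sum>j<k. card (miss j))" by (rule card_UN_le) simp
  finally have "real (card {g \<in> P \<rightarrow>\<^sub>E {..<k}. g ` D \<noteq> {..<k}}) \<le> real (\<Sum>j<k. card (miss j))"
    by (rule of_nat_mono)
  also have "\<dots> = (\<Sum>j<k. real (card (miss j)))" by simp
  also have "\<dots> = real k ^ card P * (real k * (1 - 1 / real k) ^ card D)"
    using miss by simp
  finally show ?thesis .
qed

text \<open>The first moment argument, written with cardinalities. For fixed \<open>W\<close>, the events at different
lines are independent, so all lines fail with probability at most
\<open>k ^ n * (1 - 1 / k) ^ (\<Sum>l\<in>L. card (inc l \<inter> W))\<close>, where \<open>n\<close> is the number of points and of lines. The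
exponent is \<open>q * card W\<close> by double counting, and exceeds \<open>2 * n * k * ln k\<close> if \<open>card W\<close> is at least
\<open>n / r\<close>. Since \<open>1 - 1 / k \<le> exp (- 1 / k)\<close>, the probability is below
\<open>k ^ n * (1 / k) ^ (2 * n) \<le> (1 / 2) ^ n\<close>, and there are at most \<open>2 ^ n\<close> sets \<open>W\<close>.\<close>

lemma exists_line_partition_meeting_large_sets:
  fixes P :: "'p set" and L :: "'l set" and inc :: "'l \<Rightarrow> 'p set"
  assumes P: "finite P" "P \<noteq> {}" and L: "finite L" "card L = card P"
    and inc: "\<And>l. l \<in> L \<Longrightarrow> inc l \<subseteq> P" and reg: "\<And>p. p \<in> P \<Longrightarrow> card {l \<in> L. p \<in> inc l} = q"
    and k: "2 \<le> k" and q: "2 * real k * real r * ln (real k) < real q"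
  shows "\<exists>f. (\<forall>l\<in>L. \<forall>p\<in>P. f l p < k) \<and>
    (\<forall>W\<subseteq>P. card P \<le> r * card W \<longrightarrow> (\<exists>l\<in>L. f l ` (inc l \<inter> W) = {..<k}))"
proof -
  define n where "n = card P"
  have n: "0 < n" using P by (simp add: n_def card_gt_0_iff)
  define \<Omega> where "\<Omega> = L \<rightarrow>\<^sub>E (P \<rightarrow>\<^sub>E {..<k})"
  define bad where "bad W = {f \<in> \<Omega>. \<forall>l\<in>L. f l ` (inc l \<inter> W) \<noteq> {..<k}}" for W
  have fin: "finite \<Omega>" unfolding \<Omega>_def using P L by (intro finite_PiE) auto
  have card_\<Omega>: "card \<Omega> = (k ^ n) ^ n"
    using P L by (simp add: \<Omega>_def card_funcsetE n_def)
  \<comment> \<open>the union bound over all \<open>W\<close>, at most \<open>2 ^ n\<close> of them, is prepared by this factor\<close>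
  have few: "2 ^ n * card (bad W) < card \<Omega>" if W: "W \<subseteq> P" "n \<le> r * card W" for W
  proof -
    define G where "G l = {g \<in> P \<rightarrow>\<^sub>E {..<k}. g ` (inc l \<inter> W) \<noteq> {..<k}}" for l
    have finG: "finite (G l)" for l
      unfolding G_def using P by (intro finite_subset[OF _ finite_PiE[of P "\<lambda>_. {..<k}"]]) auto
    have "bad W \<subseteq> Pi\<^sub>E L G" by (auto simp: bad_def \<Omega>_def G_def PiE_iff extensional_def)
    then have "card (bad W) \<le> card (Pi\<^sub>E L G)"
      using L finG by (intro card_mono finite_PiE) auto
    then have "real (card (bad W)) \<le> (\<Prod>l\<in>L. real (card (G l)))"
      using L by (simp add: card_PiE flip: of_nat_prod)
    also have "\<dots> \<le> (\<Prod>l\<in>L. real k ^ n * (real k * (1 - 1 / real k) ^ card (inc l \<inter> W)))"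
      unfolding G_def n_def using P inc k by (intro prod_mono conjI card_functions_missing_value) auto
    also have "\<dots> = real (card \<Omega>) * (real k ^ n * (1 - 1 / real k) ^ (\<Sum>l\<in>L. card (inc l \<inter> W)))"
      using L by (simp add: prod.distrib card_\<Omega> n_def power_sum)
    also have "(\<Sum>l\<in>L. card (inc l \<inter> W)) = q * card W"
    proof -
      have finW: "finite W" using W P finite_subset by blast
      have "(\<Sum>l\<in>L. card (inc l \<inter> W)) = (\<Sum>l\<in>L. \<Sum>p\<in>W. if p \<in> inc l then 1 else 0)"
        using finW by (simp add: sum.If_cases Int_commute)
      also have "\<dots> = (\<Sum>p\<in>W. \<Sum>l\<in>L. if p \<in> inc l then 1 else 0)" by (rule sum.swap)
      also have "\<dots> = (\<Sum>p\<in>W. card {l \<in> L. p \<in> inc l})"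
        using L by (simp add: sum.If_cases Int_def)
      also have "\<dots> = q * card W" using reg W by (simp add: subset_iff)
      finally show ?thesis .
    qed
    also have "(1 - 1 / real k) ^ (q * card W) < (1 / real k) ^ (2 * n)"
    proof -
      have "0 < card W" using n W(2) by (cases "card W") auto
      have lnk: "0 < ln (real k)" using k by simp
      have "2 * real n * ln (real k) \<le> 2 * (real r * real (card W)) * ln (real k)"
        using W(2) lnk by (intro mult_right_mono mult_left_mono) (simp_all flip: of_nat_mult)
      also have "\<dots> = (2 * real k * real r * ln (real k)) * (real (card W) / real k)"
        using k by (simp add: field_simps)
      also have "\<dots> < real q * (real (card W) / real k)"
        using q \<open>0 < card W\<close> k by (intro mult_strict_right_mono) auto
      finally have exponent: "2 * real n * ln (real k) < real (q * card W) / real k" by simp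
      have "(1 - 1 / real k) ^ (q * card W) \<le> exp (- (1 / real k)) ^ (q * card W)"
        using k exp_ge_add_one_self[of "- (1 / real k)"] by (intro power_mono) auto
      also have "\<dots> = exp (- (real (q * card W) / real k))"
        by (simp flip: exp_of_nat_mult)
      also have "\<dots> < exp (- (2 * real n * ln (real k)))" using exponent by simp
      also have "\<dots> = exp (- ln (real k)) ^ (2 * n)"
        by (simp flip: exp_of_nat_mult)
      also have "exp (- ln (real k)) = 1 / real k" using k by (simp add: exp_minus field_simps)
      finally show ?thesis .
    qed
    finally have "real (card (bad W)) < real (card \<Omega>) * (real k ^ n * (1 / real k) ^ (2 * n))"
      using k card_\<Omega> by simp
    also have "real k ^ n * (1 / real k) ^ (2 * n) = 1 / real k ^ n"
      using k by (simp add: power_mult power2_eq_square power_mult_distrib field_simps)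
    finally have "real k ^ n * real (card (bad W)) < real (card \<Omega>)"
      using k by (simp add: field_simps)
    moreover have "2 ^ n * real (card (bad W)) \<le> real k ^ n * real (card (bad W))"
      using k by (intro mult_right_mono power_mono) auto
    ultimately have "real (2 ^ n * card (bad W)) < real (card \<Omega>)" by simp
    then show ?thesis by (simp only: of_nat_less_iff)
  qed
  define \<W> where "\<W> = {W. W \<subseteq> P \<and> n \<le> r * card W}"
  have "\<W> \<subseteq> Pow P" by (auto simp: \<W>_def)
  then have fin\<W>: "finite \<W>" and card\<W>: "card \<W> \<le> 2 ^ n"
    using P card_mono[of "Pow P" \<W>] finite_subset by (auto simp: n_def card_Pow)
  have "\<not> \<Omega> \<subseteq> (\<Union>W\<in>\<W>. bad W)"
  proof
    assume sub: "\<Omega> \<subseteq> (\<Union>W\<in>\<W>. bad W)"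
    have "0 < card \<Omega>" using k by (simp add: card_\<Omega>)
    then have "\<W> \<noteq> {}" using sub by auto
    have "card \<Omega> \<le> card (\<Union>W\<in>\<W>. bad W)"
      using fin\<W> fin by (intro card_mono[OF _ sub] finite_UN_I) (auto simp: bad_def)
    also have "\<dots> \<le> (\<Sum>W\<in>\<W>. card (bad W))" using fin\<W> by (rule card_UN_le)
    finally have "2 ^ n * card \<Omega> \<le> (\<Sum>W\<in>\<W>. 2 ^ n * card (bad W))"
      by (simp flip: sum_distrib_left)
    also have "\<dots> < (\<Sum>W\<in>\<W>. card \<Omega>)"
      using fin\<W> \<open>\<W> \<noteq> {}\<close> few by (intro sum_strict_mono) (auto simp: \<W>_def)
    also have "\<dots> \<le> 2 ^ n * card \<Omega>" using card\<W> by simp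
    finally show False by simp
  qed
  then obtain f where f: "f \<in> \<Omega>" "\<And>W. W \<in> \<W> \<Longrightarrow> f \<notin> bad W" by blast
  have "\<forall>l\<in>L. \<forall>p\<in>P. f l p < k" using f(1) by (auto simp: \<Omega>_def PiE_iff)
  moreover have "\<exists>l\<in>L. f l ` (inc l \<inter> W) = {..<k}" if "W \<subseteq> P" "card P \<le> r * card W" for W
    using f that by (auto simp: \<W>_def bad_def n_def)
  ultimately show ?thesis by blast
qed

section \<open>A triangle-free geometry of lines over a field\<close>

text \<open>The line with direction \<open>(1, t, t\<^sup>2 + \<gamma>)\<close> through \<open>(0, b, d)\<close>. For fixed \<open>\<gamma>\<close>, the directions are the affine
points of a conic in the plane at infinity, and different \<open>\<gamma>\<close> have no direction in common.\<close>

definition space_line :: "'a::field set \<Rightarrow> 'a \<Rightarrow> 'a \<times> 'a \<times> 'a \<Rightarrow> ('a \<times> 'a \<times> 'a) set" where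
  "space_line F \<gamma> = (\<lambda>(t, b, d). {(x, b + x * t, d + x * (t ^ 2 + \<gamma>)) | x. x \<in> F})"

text \<open>Two points of a line differ in the first coordinate. Dividing the differences of the other two
coordinates by that of the first one recovers \<open>t\<close> and \<open>t\<^sup>2 + \<gamma>\<close>, hence the line and its class.\<close>

lemma space_line_unique:
  assumes "p \<in> space_line F \<gamma> l" "p' \<in> space_line F \<gamma> l" "p \<in> space_line F \<gamma>' l'" "p' \<in> space_line F \<gamma>' l'"
    and "p \<noteq> p'"
  shows "l = l' \<and> \<gamma> = \<gamma>'"
proof -
  obtain t b d where l: "l = (t, b, d)" by (cases l)
  obtain t' b' d' where l': "l' = (t', b', d')" by (cases l')
  obtain x where x: "p = (x, b + x * t, d + x * (t ^ 2 + \<gamma>))" using assms(1) by (auto simp: space_line_def l)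
  obtain y where y: "p' = (y, b + y * t, d + y * (t ^ 2 + \<gamma>))" using assms(2) by (auto simp: space_line_def l)
  have x': "b + x * t = b' + x * t'" "d + x * (t ^ 2 + \<gamma>) = d' + x * (t' ^ 2 + \<gamma>')"
    using assms(3) by (auto simp: space_line_def l' x)
  have y': "b + y * t = b' + y * t'" "d + y * (t ^ 2 + \<gamma>) = d' + y * (t' ^ 2 + \<gamma>')"
    using assms(4) by (auto simp: space_line_def l' y)
  have "x \<noteq> y" using assms(5) x y by auto
  have "(x - y) * t = (b + x * t) - (b + y * t)" by (simp add: algebra_simps)
  also have "\<dots> = (x - y) * t'" unfolding x' y' by (simp add: algebra_simps)
  finally have t: "t = t'" using \<open>x \<noteq> y\<close> by simp
  have "(x - y) * (t ^ 2 + \<gamma>) = (d + x * (t ^ 2 + \<gamma>)) - (d + y * (t ^ 2 + \<gamma>))" by (simp add: algebra_simps)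
  also have "\<dots> = (x - y) * (t' ^ 2 + \<gamma>')" unfolding x' y' by (simp add: algebra_simps)
  finally have "t ^ 2 + \<gamma> = t' ^ 2 + \<gamma>'" using \<open>x \<noteq> y\<close> by simp
  then have \<gamma>: "\<gamma> = \<gamma>'" using t by simp
  show ?thesis using x' t \<gamma> by (simp add: l l')
qed

text \<open>The sides of a triangle would give three coplanar directions. In coordinates, if the first coordinates
differ by \<open>s\<close> and \<open>u\<close> along two sides with parameters \<open>t\<close> and \<open>t'\<close>, the parameter \<open>t''\<close> of the third side
satisfies \<open>(s + u) * t'' = s * t + u * t'\<close> and \<open>(s + u) * t''\<^sup>2 = s * t\<^sup>2 + u * t'\<^sup>2\<close>. The square
of the first equation and \<open>s + u\<close> times the second one have equal left-hand sides, and their right-hand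
sides differ by \<open>s * u * (t - t')\<^sup>2\<close>, so \<open>t = t'\<close>.\<close>

lemma space_line_triangle_free:
  assumes p12: "p1 \<in> space_line F \<gamma> l" "p2 \<in> space_line F \<gamma> l"
    and p23: "p2 \<in> space_line F \<gamma> l'" "p3 \<in> space_line F \<gamma> l'"
    and p13: "p1 \<in> space_line F \<gamma> l''" "p3 \<in> space_line F \<gamma> l''"
    and neq: "p1 \<noteq> p2" "p2 \<noteq> p3" "p1 \<noteq> p3"
  shows "p3 \<in> space_line F \<gamma> l"
proof -
  obtain t b d where l: "l = (t, b, d)" by (cases l)
  obtain t' b' d' where l': "l' = (t', b', d')" by (cases l')
  obtain t'' b'' d'' where l'': "l'' = (t'', b'', d'')" by (cases l'')
  obtain x1 y1 z1 where p1: "p1 = (x1, y1, z1)" by (cases p1)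
  obtain x2 y2 z2 where p2: "p2 = (x2, y2, z2)" by (cases p2)
  obtain x3 y3 z3 where p3: "p3 = (x3, y3, z3)" by (cases p3)
  have e: "y1 = b + x1 * t" "z1 = d + x1 * (t ^ 2 + \<gamma>)" "y2 = b + x2 * t" "z2 = d + x2 * (t ^ 2 + \<gamma>)"
    using p12 by (auto simp: space_line_def l p1 p2)
  have e': "y2 = b' + x2 * t'" "z2 = d' + x2 * (t' ^ 2 + \<gamma>)" "y3 = b' + x3 * t'" "z3 = d' + x3 * (t' ^ 2 + \<gamma>)"
    using p23 by (auto simp: space_line_def l' p2 p3)
  have e'': "y1 = b'' + x1 * t''" "z1 = d'' + x1 * (t'' ^ 2 + \<gamma>)" "y3 = b'' + x3 * t''" "z3 = d'' + x3 * (t'' ^ 2 + \<gamma>)"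
    using p13 by (auto simp: space_line_def l'' p1 p3)
  have F3: "x3 \<in> F" using p13 by (auto simp: space_line_def l'' p3)
  have x: "x1 \<noteq> x2" "x2 \<noteq> x3" using neq e e' by (auto simp: p1 p2 p3)
  define s where "s = x1 - x2"
  define u where "u = x2 - x3"
  have "(s + u) * t'' = y1 - y3" unfolding e''(1,3) s_def u_def by (simp add: algebra_simps)
  also have "\<dots> = (y1 - y2) + (y2 - y3)" by simp
  also have "y1 - y2 = s * t" unfolding e(1,3) s_def by (simp add: algebra_simps)
  also have "y2 - y3 = u * t'" unfolding e'(1,3) u_def by (simp add: algebra_simps)
  finally have m1: "(s + u) * t'' = s * t + u * t'" .
  have "(s + u) * (t'' ^ 2 + \<gamma>) = z1 - z3" unfolding e''(2,4) s_def u_def by (simp add: algebra_simps)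
  also have "\<dots> = (z1 - z2) + (z2 - z3)" by simp
  also have "z1 - z2 = s * (t ^ 2 + \<gamma>)" unfolding e(2,4) s_def by (simp add: algebra_simps)
  also have "z2 - z3 = u * (t' ^ 2 + \<gamma>)" unfolding e'(2,4) u_def by (simp add: algebra_simps)
  finally have m2: "(s + u) * t'' ^ 2 = s * t ^ 2 + u * t' ^ 2" by (simp add: algebra_simps)
  have "(s + u) * (s * t ^ 2 + u * t' ^ 2) = ((s + u) * t'') ^ 2"
    unfolding m2[symmetric] by (simp add: power2_eq_square mult_ac)
  then have "(s + u) * (s * t ^ 2 + u * t' ^ 2) - (s * t + u * t') ^ 2 = 0" unfolding m1 by simp
  moreover have "(s + u) * (s * t ^ 2 + u * t' ^ 2) - (s * t + u * t') ^ 2 = s * u * (t - t') ^ 2"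
    by (simp add: power2_eq_square algebra_simps)
  ultimately have "s * u * (t - t') ^ 2 = 0" by simp
  then have t: "t = t'" using x by (simp add: s_def u_def)
  then have "b = b'" "d = d'" using e(3,4) e'(1,2) by simp_all
  then show ?thesis using p23(2) t by (simp add: l l')
qed

lemma card_space_lines_through:
  assumes F: "finite F" "\<And>x y. x \<in> F \<Longrightarrow> y \<in> F \<Longrightarrow> x + y \<in> F \<and> x - y \<in> F \<and> x * y \<in> F"
    and \<gamma>: "\<gamma> \<in> F" and p: "p \<in> F \<times> F \<times> F"
  shows "card {l \<in> F \<times> F \<times> F. p \<in> space_line F \<gamma> l} = card F"
proof -
  obtain x y z where xyz: "p = (x, y, z)" "x \<in> F" "y \<in> F" "z \<in> F" using p by auto
  have "{l \<in> F \<times> F \<times> F. p \<in> space_line F \<gamma> l} = (\<lambda>t. (t, y - x * t, z - x * (t ^ 2 + \<gamma>))) ` F"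
  proof (intro equalityI subsetI)
    fix l assume "l \<in> {l \<in> F \<times> F \<times> F. p \<in> space_line F \<gamma> l}"
    then obtain t b d where "l = (t, b, d)" "t \<in> F" "y = b + x * t" "z = d + x * (t ^ 2 + \<gamma>)"
      by (auto simp: space_line_def xyz)
    then show "l \<in> (\<lambda>t. (t, y - x * t, z - x * (t ^ 2 + \<gamma>))) ` F" by auto
  next
    fix l assume "l \<in> (\<lambda>t. (t, y - x * t, z - x * (t ^ 2 + \<gamma>))) ` F"
    then obtain t where "t \<in> F" "l = (t, y - x * t, z - x * (t ^ 2 + \<gamma>))" by auto
    then show "l \<in> {l \<in> F \<times> F \<times> F. p \<in> space_line F \<gamma> l}"
      using xyz F(2) \<gamma> by (auto simp: space_line_def power2_eq_square)
  qed
  then show ?thesis by (simp add: card_image inj_on_def)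
qed

text \<open>Two points are adjacent in colour \<open>j\<close> if they lie on a line of class \<open>j\<close>, in different parts of its
partition. A monochromatic clique lies on a single line, because there are no triangles, and has at most one
point in each of the \<open>k\<close> parts.\<close>

lemma exists_dense_clique_free_colouring:
  fixes F :: "'a::field set"
  assumes F: "finite F" "F \<noteq> {}" "\<And>x y. x \<in> F \<Longrightarrow> y \<in> F \<Longrightarrow> x + y \<in> F \<and> x - y \<in> F \<and> x * y \<in> F"
    and k: "2 \<le> k" and rF: "r \<le> card F"
    and large: "2 * real k * real r * ln (real k) < real (card F)"
  shows "\<exists>c. clique_free_colouring r (k + 1) (F \<times> F \<times> F) c \<and>
    (\<forall>W \<subseteq> F \<times> F \<times> F. card (F \<times> F \<times> F) \<le> r * card W \<longrightarrow>
      (\<forall>j<r. \<exists>K\<subseteq>W. card K = k \<and> (\<forall>u\<in>K. \<forall>v\<in>K. u \<noteq> v \<longrightarrow> c u v = j)))"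
proof -
  define P where "P = F \<times> F \<times> F"
  obtain \<gamma> where \<gamma>: "\<gamma> ` {..<r} \<subseteq> F" "inj_on \<gamma> {..<r}"
    using card_le_inj[of "{..<r}" F] F(1) rF by auto
  define inc where "inc j = space_line F (\<gamma> j)" for j
  have inc_P: "inc j l \<subseteq> P" if "j < r" "l \<in> P" for j l
    using that \<gamma>(1) F(3) by (auto simp: inc_def space_line_def P_def power2_eq_square)
  have "\<exists>f. (\<forall>l\<in>P. \<forall>p\<in>P. f l p < k) \<and>
    (\<forall>W\<subseteq>P. card P \<le> r * card W \<longrightarrow> (\<exists>l\<in>P. f l ` (inc j l \<inter> W) = {..<k}))" if j: "j < r" for j
  proof (rule exists_line_partition_meeting_large_sets[where q = "card F"])
    show "card {l \<in> P. p \<in> inc j l} = card F" if "p \<in> P" for p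
      unfolding P_def inc_def using F(1,3) \<gamma>(1) j that by (intro card_space_lines_through) (auto simp: P_def)
  qed (use F k large inc_P j in \<open>auto simp: P_def\<close>)
  then obtain f where f: "\<And>j l p. j < r \<Longrightarrow> l \<in> P \<Longrightarrow> p \<in> P \<Longrightarrow> f j l p < k"
    and hit: "\<And>j W. j < r \<Longrightarrow> W \<subseteq> P \<Longrightarrow> card P \<le> r * card W \<Longrightarrow>
      \<exists>l\<in>P. f j l ` (inc j l \<inter> W) = {..<k}"
    by metis
  define adj where "adj j p p' \<longleftrightarrow> p \<noteq> p' \<and> (\<exists>l\<in>P. p \<in> inc j l \<and> p' \<in> inc j l \<and> f j l p \<noteq> f j l p')"
    for j p p'
  have adj_sym: "adj j p p' \<longleftrightarrow> adj j p' p" for j p p' by (auto simp: adj_def)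
  have adj_unique: "i = j" if "adj i p p'" "adj j p p'" "i < r" "j < r" for i j p p'
  proof -
    have "\<gamma> i = \<gamma> j"
      using that(1,2) space_line_unique unfolding adj_def inc_def by blast
    then show ?thesis using \<gamma>(2) that by (auto simp: inj_on_def)
  qed
  define c where "c p p' = (if \<exists>j<r. adj j p p' then THE j. j < r \<and> adj j p p' else r)" for p p'
  have c_adj: "c p p' = j" if j: "j < r" "adj j p p'" for j p p'
  proof -
    have "(THE j. j < r \<and> adj j p p') = j"
    proof (rule the_equality)
      show "i = j" if "i < r \<and> adj i p p'" for i
        using adj_unique[of i p p' j] that j by simp
    qed (use j in simp)
    then show ?thesis using j by (auto simp: c_def)
  qed
  have c_cases: "c p p' = r \<or> (c p p' < r \<and> adj (c p p') p p')" for p p'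
  proof (cases "\<exists>j<r. adj j p p'")
    case True
    then obtain j where "j < r" "adj j p p'" by blast
    then show ?thesis using c_adj[of j p p'] by simp
  next
    case False
    then have "c p p' = r" unfolding c_def by (rule if_not_P)
    then show ?thesis ..
  qed
  have "clique_free_colouring r (k + 1) P c"
    unfolding clique_free_colouring_def
  proof (intro conjI allI impI ballI)
    show "finite P" using F(1) by (simp add: P_def)
    show "c u v \<le> r" for u v using c_cases[of u v] by auto
    show "c u v = c v u" for u v
      using c_cases[of u v] c_cases[of v u] c_adj adj_sym by metis
    show "c v v = r" for v using c_cases[of v v] by (auto simp: adj_def)
    fix S j assume S: "S \<subseteq> P" "j < r" "card S = k + 1"
    show "\<exists>u\<in>S. \<exists>v\<in>S. u \<noteq> v \<and> c u v \<noteq> j"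
    proof (rule ccontr)
      assume "\<not> ?thesis"
      then have adj: "adj j u v" if "u \<in> S" "v \<in> S" "u \<noteq> v" for u v
        using c_cases[of u v] S(2) that by auto
      have "\<not> card S \<le> Suc 0" using S(3) k by simp
      moreover have finS: "finite S" using S(3) card.infinite by fastforce
      ultimately obtain u v where uv: "u \<in> S" "v \<in> S" "u \<noteq> v"
        using card_le_Suc0_iff_eq[OF finS] by blast
      obtain l where l: "l \<in> P" "u \<in> inc j l" "v \<in> inc j l"
        using adj[OF uv] by (auto simp: adj_def)
      have on_l: "w \<in> inc j l" if w: "w \<in> S" for w
      proof (cases "w = u \<or> w = v")
        case False
        obtain l' l'' where "v \<in> inc j l'" "w \<in> inc j l'" "u \<in> inc j l''" "w \<in> inc j l''"
          using adj[of v w] adj[of u w] uv w False by (auto simp: adj_def)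
        then show ?thesis
          using space_line_triangle_free[of u F "\<gamma> j" l v l' w l''] l uv False by (auto simp: inc_def)
      qed (use l in auto)
      have "inj_on (f j l) S"
      proof (rule inj_onI, rule ccontr)
        fix x y assume xy: "x \<in> S" "y \<in> S" "f j l x = f j l y" "x \<noteq> y"
        then obtain l' where l': "x \<in> inc j l'" "y \<in> inc j l'" "f j l' x \<noteq> f j l' y"
          using adj[of x y] by (auto simp: adj_def)
        then have "l = l'"
          using space_line_unique[of x F "\<gamma> j" l y "\<gamma> j" l'] on_l xy by (auto simp: inc_def)
        then show False using l' xy by simp
      qed
      moreover have "f j l ` S \<subseteq> {..<k}"
      proof (rule image_subsetI)
        fix x assume "x \<in> S"
        then show "f j l x \<in> {..<k}" using f[OF S(2) l(1)] S(1) by blast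
      qed
      ultimately have "card S \<le> card {..<k}" by (intro card_inj_on_le) auto
      then show False using S(3) by simp
    qed
  qed
  moreover have "\<exists>K\<subseteq>W. card K = k \<and> (\<forall>u\<in>K. \<forall>v\<in>K. u \<noteq> v \<longrightarrow> c u v = j)"
    if W: "W \<subseteq> P" "card P \<le> r * card W" and j: "j < r" for W j
  proof -
    obtain l where l: "l \<in> P" "f j l ` (inc j l \<inter> W) = {..<k}"
      using hit j W by blast
    then obtain K where K: "K \<subseteq> inc j l \<inter> W" "inj_on (f j l) K" "{..<k} = f j l ` K"
      using subset_image_inj[of "{..<k}" "f j l" "inc j l \<inter> W"] by auto
    have "card K = k" using card_image[OF K(2)] K(3) by (metis card_lessThan)
    moreover have "c u v = j" if "u \<in> K" "v \<in> K" "u \<noteq> v" for u v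
      using that K l(1) by (intro c_adj[OF j]) (auto simp: adj_def inj_on_def)
    ultimately show ?thesis using K(1) by blast
  qed
  ultimately show ?thesis unfolding P_def by blast
qed

section \<open>Finite fields of characteristic two\<close>

lemma CHAR_bit: "CHAR(bit) = 2"
proof (rule CHAR_eqI)
  show "of_nat 2 = (0 :: bit)" by simp
  fix n :: nat assume "of_nat n = (0 :: bit)"
  then have "even (of_nat n :: bit)" by (simp only: dvd_0_right)
  then show "2 dvd n" by (simp only: even_of_nat_iff)
qed

text \<open>The roots of \<open>x ^ q - x\<close> with \<open>q = 2 ^ m\<close> in an algebraically closed field of characteristic two.
They are simple, since the derivative of this polynomial is \<open>- 1\<close>, so that there are \<open>q\<close> of them, and they
are closed under addition as \<open>x \<mapsto> x ^ q\<close> is additive. A power of two is used because one lies between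
\<open>x\<close> and \<open>2 * x\<close> for every \<open>x \<ge> 1\<close>.\<close>

lemma finite_subfield_of_card_power_of_2:
  "\<exists>F :: bit alg_closure set. finite F \<and> card F = 2 ^ m \<and>
     (\<forall>x\<in>F. \<forall>y\<in>F. x + y \<in> F \<and> x - y \<in> F \<and> x * y \<in> F)"
proof (cases "m = 0")
  case True
  then show ?thesis by (intro exI[of _ "{0}"]) auto
next
  case False
  define q :: nat where "q = 2 ^ m"
  have q: "q > 1" unfolding q_def using False by (intro one_less_power) auto
  have q2: "even q" unfolding q_def using False by simp
  have char: "CHAR(bit alg_closure) = 2" by (simp add: CHAR_bit)
  define F where "F = {x :: bit alg_closure. x ^ q = x}"
  define p :: "bit alg_closure poly" where "p = monom 1 q - monom 1 1"
  have p: "poly p x = x ^ q - x" for x by (simp add: p_def poly_monom)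
  have "coeff p q = 1" using q by (simp add: p_def)
  moreover have "Polynomial.degree p \<le> q"
    unfolding p_def using q by (intro degree_diff_le) (auto intro: degree_monom_le order_trans[OF degree_monom_le])
  ultimately have deg: "Polynomial.degree p = q"
    by (simp add: antisym le_degree)
  have "of_nat q = (0 :: bit alg_closure)"
    using q2 char by (simp add: of_nat_eq_0_iff_char_dvd)
  then have pd: "pderiv p = [:- 1:]"
    by (simp add: p_def pderiv_diff pderiv_monom monom_0)
  have p0: "p \<noteq> 0" using deg q by auto
  have F: "F = {x. poly p x = 0}" by (auto simp: F_def p)
  \<comment> \<open>a double root of \<open>p\<close> would be a root of the constant \<open>pderiv p\<close>\<close>
  have "order a p < 2" for a
  proof (rule ccontr)
    assume "\<not> order a p < 2"
    then have "[:-a, 1:] ^ 2 dvd p" by (simp add: order_divides)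
    then obtain s where "p = [:-a, 1:] ^ 2 * s" by (elim dvdE)
    then have "poly (pderiv p) a = 0"
      by (simp only: pderiv_mult power2_eq_square poly_mult poly_add) simp
    then show False by (simp add: pd)
  qed
  then have "order a p = 0 \<or> order a p = 1" for a
    by (metis less_2_cases One_nat_def)
  then have ord: "order a p = (if a \<in> F then 1 else 0)" for a
    using p0 order_root[of p a] by (metis F mem_Collect_eq zero_neq_one)
  obtain A where A: "size A = Polynomial.degree p" "p = smult (lead_coeff p) (\<Prod>x\<in>#A. [:-x, 1:])"
    using alg_closed_imp_factorization[OF p0] by blast
  have "proots p = proots (\<Prod>x\<in>#A. [:-x, 1:])"
    using A p0 by (metis leading_coeff_0_iff proots_smult)
  also have "\<dots> = A"
  proof (induction A)
    case (add x A)
    have "(\<Prod>x\<in>#A. [:-x, 1:]) \<noteq> 0" by (auto simp: prod_mset_zero_iff)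
    then have "proots ([:-x, 1:] * (\<Prod>x\<in>#A. [:-x, 1:])) = proots [:-x, 1:] + A"
      using add by (subst proots_mult) auto
    also have "proots [:-x, 1:] = {#x#}" by (subst proots_linear_factor) simp
    finally show ?case by simp
  qed simp
  finally have "size (proots p) = q" using A deg by simp
  moreover have "proots p = mset_set F"
    by (rule multiset_eqI) (use p0 ord in \<open>auto simp: F poly_roots_finite count_mset_set'\<close>)
  ultimately have "card F = q" by simp
  moreover have "finite F" using p0 by (simp add: F poly_roots_finite)
  moreover have add: "(x + y) ^ q = x ^ q + y ^ q" for x y :: "bit alg_closure"
    by (rule freshmans_dream'[where n = m]) (simp_all add: CHAR_bit q_def)
  have uminus: "- x = x" for x :: "bit alg_closure"
  proof -
    have "of_nat 2 = (0 :: bit alg_closure)" using char of_nat_CHAR by metis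
    then have "x + x = 0" by (metis mult_2 mult_zero_left of_nat_numeral)
    then show ?thesis by (simp add: eq_neg_iff_add_eq_0 [symmetric])
  qed
  have "x + y \<in> F" "x * y \<in> F" if "x \<in> F" "y \<in> F" for x y
    using that by (simp_all add: F_def add power_mult_distrib)
  moreover from this have "x - y \<in> F" if "x \<in> F" "y \<in> F" for x y
    using that uminus by (metis diff_conv_add_uminus)
  ultimately show ?thesis by (intro exI[of _ F]) (auto simp: q_def)
qed

section \<open>The upper bound\<close>

theorem theorem1p4:
  fixes k r :: nat
  assumes "k \<ge> 2" and "r \<ge> 3"
  shows "real (smallest_min_degree r (complete_graph (k + 1)))
           \<le> (8 * real k * real r * ln (real k)) ^ 3"
proof -
  define x where "x = 2 * real k * real r * ln (real k)"
  have "1 / 2 \<le> ln (2 :: real)"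
    using ln_le_minus_one[of "1 / 2 :: real"] by (simp add: ln_div)
  also have "\<dots> \<le> ln (real k)" using assms(1) by simp
  finally have ln_k: "1 / 2 \<le> ln (real k)" .
  have "2 * 1 \<le> (2 * real k) * ln (real k)"
    using assms(1) ln_k mult_mono[of 4 "2 * real k" "1 / 2" "ln (real k)"] by simp
  then have "real r * 1 \<le> real r * (2 * real k * ln (real k))" by (intro mult_left_mono) auto
  then have x: "real r \<le> x" by (simp add: x_def mult_ac)
  \<comment> \<open>the least power of two above \<open>x\<close> is at most \<open>2 * x\<close>, while the theorem has room for \<open>4 * x\<close>\<close>
  define m where "m = (LEAST m. x < 2 ^ m)"
  have "\<exists>m. x < 2 ^ m" using real_arch_pow[of 2 x] by simp
  then have m: "x < 2 ^ m" unfolding m_def by (rule LeastI_ex)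
  have m_le: "2 ^ m \<le> 2 * x"
  proof (cases m)
    case 0
    then show ?thesis using x assms(2) by simp
  next
    case (Suc m')
    then have "\<not> x < 2 ^ m'" using not_less_Least[of m' "\<lambda>m. x < 2 ^ m"] by (simp add: m_def)
    then show ?thesis using Suc by simp
  qed
  obtain F :: "bit alg_closure set" where F: "finite F" "card F = 2 ^ m"
    "\<forall>x\<in>F. \<forall>y\<in>F. x + y \<in> F \<and> x - y \<in> F \<and> x * y \<in> F"
    using finite_subfield_of_card_power_of_2 by blast
  have large: "x < real (card F)" using m F(2) by simp
  then have "real r < real (card F)" using x by linarith
  then have rF: "r \<le> card F" by simp
  have "F \<noteq> {}" using F(2) by auto
  then obtain c where c: "clique_free_colouring r (k + 1) (F \<times> F \<times> F) c"
    and dense: "\<forall>W \<subseteq> F \<times> F \<times> F. card (F \<times> F \<times> F) \<le> r * card W \<longrightarrow>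
      (\<forall>j<r. \<exists>K\<subseteq>W. card K = k \<and> (\<forall>u\<in>K. \<forall>v\<in>K. u \<noteq> v \<longrightarrow> c u v = j))"
    using exists_dense_clique_free_colouring[of F k r] F assms(1) rF large[unfolded x_def] by blast
  have "smallest_min_degree r (complete_graph (k + 1)) \<le> card (F \<times> F \<times> F)"
    using assms dense by (intro smallest_min_degree_le_card[OF _ _ c]) auto
  also have "\<dots> = (2 ^ m) ^ 3"
    using F(2) by (simp add: card_cartesian_product power3_eq_cube)
  finally have "real (smallest_min_degree r (complete_graph (k + 1))) \<le> (2 ^ m) ^ 3"
    by (metis of_nat_le_iff of_nat_numeral of_nat_power)
  also have "\<dots> \<le> (8 * real k * real r * ln (real k)) ^ 3"
  proof (rule power_mono)
    have "0 \<le> x" using x by linarith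
    then show "2 ^ m \<le> 8 * real k * real r * ln (real k)" using m_le by (simp add: x_def)
  qed simp
  finally show ?thesis .
qed

end
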